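(* Suppose that $G$ is an étale groupoid and that $G^{(0)}$ is a manifold. Then the following are equivalent: (1) $G$ acts smoothly on $G^{(0)}$; (2) there is a manifold structure on $G$ with respect to which it is an étale Lie groupoid; (3) the manifold structure on $G$ given by the atlas $\mathcal{R}$ (described in the context) is the unique manifold structure on $G$ with respect to which it is an étale Lie groupoid.
   Context: "Manifold" means smooth manifold: Hausdorff, second-countable, locally Euclidean, with a maximal smooth atlas. Manifold structures on $G$ are always compatible with the given topology of $G$, and $G^{(0)}$ always carries its given smooth structure; uniqueness is as maximal atlases. All groupoids are locally compact Hausdorff topological groupoids with unit space $G^{(0)}\subseteq G$ (subspace topology), continuous surjective range and source maps $r,s:G\to G^{(0)}$, and continuous composition and inversion. $G$ is étale if $r,s$ are local homeomorphisms; an open bisection is an open $U\subseteq G$ such that $r|_U,s|_U$ are homeomorphisms onto open subsets of $G^{(0)}$. A Lie groupoid is a topological groupoid such that $G,G^{(0)}$ are manifolds, $G^{(0)}\hookrightarrow G$ is a smooth embedding, $r,s$ are submersions (smooth maps with everywhere surjective differential), and composition and inversion are smooth. A Lie groupoid is étale if $r,s$ are local diffeomorphisms. For $G$ étale with $G^{(0)}$ a manifold, an open bisection $B$ acts smoothly on $G^{(0)}$ if $s|_B\circ(r|_B)^{-1}:r(B)\to s(B)$ is a diffeomorphism; $G$ acts smoothly on $G^{(0)}$ if it admits a cover by open bisections that act smoothly on $G^{(0)}$. The atlas $\mathcal{R}$: let $\{(W_\alpha,\psi_\alpha)\}_{\alpha\in\mathfrak{A}}$ be a smooth atlas for $G^{(0)}$.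 Then $\mathcal{R}$ consists of all pairs $(B,\psi_\alpha\circ r|_B)$, where $\alpha\in\mathfrak{A}$ and $B$ is an open bisection of $G$ with $r(B)\subseteq W_\alpha$. (This is an atlas for a smooth structure on $G$.)
   Formalization: The implication from (1) to (2) is stated only for second-countable G, since it fails for an uncountable discrete group, which acts smoothly on its one-point unit space but has no manifold structure; (2) implies (1) and (2) iff (3) are stated for every étale G. *)

theory Defs
  imports "HOL-Analysis.Analysis"
begin

section \<open>Smooth maps between open subsets of Cartesian spaces\<close>

text \<open>
  The n-dimensional Cartesian space is the library's \<^term>\<open>Euclidean_space n\<close>, whose points are the
  \<^typ>\<open>nat \<Rightarrow> real\<close> with all coordinates from n on equal to 0.  Dimensions are thus terms, so they can be
  quantified over, and dimension 0 is included.
\<close>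

definition partial_deriv :: "nat \<Rightarrow> ((nat \<Rightarrow> real) \<Rightarrow> real) \<Rightarrow> (nat \<Rightarrow> real) \<Rightarrow> real" where
  "partial_deriv j f x = deriv (\<lambda>t. f (x(j := t))) (x j)"

text \<open>All partial derivatives of order at most k exist and are continuous on S (S open).\<close>

primrec Ck_on :: "nat \<Rightarrow> nat \<Rightarrow> (nat \<Rightarrow> real) set \<Rightarrow> ((nat \<Rightarrow> real) \<Rightarrow> real) \<Rightarrow> bool" where
  "Ck_on 0 m S f \<longleftrightarrow> continuous_map (subtopology (Euclidean_space m) S) euclideanreal f"
| "Ck_on (Suc k) m S f \<longleftrightarrow>
     continuous_map (subtopology (Euclidean_space m) S) euclideanreal f \<and>
     (\<forall>j<m. (\<forall>x\<in>S. (\<lambda>t. f (x(j := t))) field_differentiable at (x j)) \<and>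
            Ck_on k m S (partial_deriv j f))"

definition smooth_on ::
    "nat \<Rightarrow> (nat \<Rightarrow> real) set \<Rightarrow> nat \<Rightarrow> ((nat \<Rightarrow> real) \<Rightarrow> nat \<Rightarrow> real) \<Rightarrow> bool" where
  "smooth_on m S n F \<longleftrightarrow>
     openin (Euclidean_space m) S \<and> F ` S \<subseteq> topspace (Euclidean_space n) \<and>
     (\<forall>i<n. \<forall>k. Ck_on k m S (\<lambda>x. F x i))"

text \<open>The differential of F at x, i.e. multiplication by the n-by-m Jacobian matrix.\<close>

definition differential ::
    "nat \<Rightarrow> nat \<Rightarrow> ((nat \<Rightarrow> real) \<Rightarrow> nat \<Rightarrow> real) \<Rightarrow> (nat \<Rightarrow> real) \<Rightarrow> (nat \<Rightarrow> real) \<Rightarrow> nat \<Rightarrow> real" where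
  "differential m n F x v =
     (\<lambda>i. if i < n then \<Sum>j<m. partial_deriv j (\<lambda>y. F y i) x * v j else 0)"


section \<open>Manifolds\<close>

text \<open>
  A chart is a triple of a dimension n, an open domain U and a coordinate map.  Only the values of the
  coordinate map on U matter: a maximal atlas contains all variants of a chart that agree on the domain.
  The dimension may vary from chart to chart.
\<close>

type_synonym 'a chart = "nat \<times> 'a set \<times> ('a \<Rightarrow> nat \<Rightarrow> real)"

fun is_chart :: "'a topology \<Rightarrow> 'a chart \<Rightarrow> bool" where
  "is_chart X (n, U, \<phi>) \<longleftrightarrow>
     openin X U \<and> openin (Euclidean_space n) (\<phi> ` U) \<and>
     homeomorphic_map (subtopology X U) (subtopology (Euclidean_space n) (\<phi> ` U)) \<phi>"

fun smoothly_compatible :: "'a chart \<Rightarrow> 'a chart \<Rightarrow> bool" where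
  "smoothly_compatible (m, U, \<phi>) (n, V, \<psi>) \<longleftrightarrow>
     smooth_on m (\<phi> ` (U \<inter> V)) n (\<psi> \<circ> inv_into U \<phi>) \<and>
     smooth_on n (\<psi> ` (U \<inter> V)) m (\<phi> \<circ> inv_into V \<psi>)"

definition smooth_atlas :: "'a topology \<Rightarrow> 'a chart set \<Rightarrow> bool" where
  "smooth_atlas X A \<longleftrightarrow>
     (\<forall>c\<in>A. is_chart X c) \<and> (\<Union>(n, U, \<phi>)\<in>A. U) = topspace X \<and>
     (\<forall>c\<in>A. \<forall>d\<in>A. smoothly_compatible c d)"

definition maximal_atlas :: "'a topology \<Rightarrow> 'a chart set \<Rightarrow> 'a chart set" where
  "maximal_atlas X A = {c. is_chart X c \<and> (\<forall>a\<in>A. smoothly_compatible c a)}"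

definition manifold :: "'a topology \<Rightarrow> 'a chart set \<Rightarrow> bool" where
  "manifold X M \<longleftrightarrow>
     Hausdorff_space X \<and> second_countable X \<and> smooth_atlas X M \<and> maximal_atlas X M = M"

definition prod_atlas :: "'a chart set \<Rightarrow> 'b chart set \<Rightarrow> ('a \<times> 'b) chart set" where
  "prod_atlas A B =
     {(m + n, U \<times> V, \<lambda>(p, q) i. if i < m then \<phi> p i else \<psi> q (i - m)) | m U \<phi> n V \<psi>.
        (m, U, \<phi>) \<in> A \<and> (n, V, \<psi>) \<in> B}"

definition prod_manifold ::
    "'a topology \<Rightarrow> 'a chart set \<Rightarrow> 'b topology \<Rightarrow> 'b chart set \<Rightarrow> ('a \<times> 'b) chart set" where
  "prod_manifold X M Y N = maximal_atlas (prod_topology X Y) (prod_atlas M N)"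

text \<open>
  Smoothness on an open set S.  The chart around p can be taken inside S because M will always be
  a maximal atlas.
\<close>

definition smooth_map :: "'a chart set \<Rightarrow> 'b chart set \<Rightarrow> 'a set \<Rightarrow> ('a \<Rightarrow> 'b) \<Rightarrow> bool" where
  "smooth_map M N S f \<longleftrightarrow>
     (\<forall>p\<in>S. \<exists>(m, U, \<phi>)\<in>M. \<exists>(n, V, \<psi>)\<in>N.
        p \<in> U \<and> U \<subseteq> S \<and> f ` U \<subseteq> V \<and> smooth_on m (\<phi> ` U) n (\<psi> \<circ> f \<circ> inv_into U \<phi>))"

text \<open>
  Smoothness on an arbitrary subset A: locally, f is the restriction of a smooth map defined on an open
  set.  For an embedded submanifold A this is smoothness with respect to its submanifold structure.
\<close>

definition smooth_map_on_subset ::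
    "'a chart set \<Rightarrow> 'b chart set \<Rightarrow> 'a set \<Rightarrow> ('a \<Rightarrow> 'b) \<Rightarrow> bool" where
  "smooth_map_on_subset M N A f \<longleftrightarrow>
     (\<forall>p\<in>A. \<exists>W F. p \<in> W \<and> smooth_map M N W F \<and> (\<forall>q\<in>A \<inter> W. F q = f q))"

definition diffeomorphism ::
    "'a chart set \<Rightarrow> 'b chart set \<Rightarrow> 'a set \<Rightarrow> 'b set \<Rightarrow> ('a \<Rightarrow> 'b) \<Rightarrow> bool" where
  "diffeomorphism M N S T f \<longleftrightarrow>
     bij_betw f S T \<and> smooth_map M N S f \<and> smooth_map N M T (inv_into S f)"

definition local_diffeomorphism ::
    "'a topology \<Rightarrow> 'a chart set \<Rightarrow> 'b topology \<Rightarrow> 'b chart set \<Rightarrow> ('a \<Rightarrow> 'b) \<Rightarrow> bool" where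
  "local_diffeomorphism X M Y N f \<longleftrightarrow>
     (\<forall>p\<in>topspace X. \<exists>U. p \<in> U \<and> openin X U \<and> openin Y (f ` U) \<and> diffeomorphism M N U (f ` U) f)"

definition submersion ::
    "'a topology \<Rightarrow> 'a chart set \<Rightarrow> 'b chart set \<Rightarrow> ('a \<Rightarrow> 'b) \<Rightarrow> bool" where
  "submersion X M N f \<longleftrightarrow>
     smooth_map M N (topspace X) f \<and>
     (\<forall>(m, U, \<phi>)\<in>M. \<forall>(n, V, \<psi>)\<in>N. \<forall>p\<in>U. f p \<in> V \<longrightarrow>
        differential m n (\<psi> \<circ> f \<circ> inv_into U \<phi>) (\<phi> p) ` topspace (Euclidean_space m)
          = topspace (Euclidean_space n))"

definition immersion ::
    "'a topology \<Rightarrow> 'a chart set \<Rightarrow> 'b chart set \<Rightarrow> ('a \<Rightarrow> 'b) \<Rightarrow> bool" where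
  "immersion X M N f \<longleftrightarrow>
     smooth_map M N (topspace X) f \<and>
     (\<forall>(m, U, \<phi>)\<in>M. \<forall>(n, V, \<psi>)\<in>N. \<forall>p\<in>U. f p \<in> V \<longrightarrow>
        inj_on (differential m n (\<psi> \<circ> f \<circ> inv_into U \<phi>) (\<phi> p)) (topspace (Euclidean_space m)))"

definition smooth_embedding ::
    "'a topology \<Rightarrow> 'a chart set \<Rightarrow> 'b topology \<Rightarrow> 'b chart set \<Rightarrow> ('a \<Rightarrow> 'b) \<Rightarrow> bool" where
  "smooth_embedding X M Y N f \<longleftrightarrow> immersion X M N f \<and> embedding_map X Y f"


section \<open>Topological groupoids\<close>

text \<open>
  A product g h is defined when the source of g is the range of h; the operations are unspecified
  outside their domains.
\<close>

record 'a groupoid =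
  arrows :: "'a topology"
  units :: "'a set"
  rng :: "'a \<Rightarrow> 'a"
  src :: "'a \<Rightarrow> 'a"
  mult :: "'a \<Rightarrow> 'a \<Rightarrow> 'a"
  invert :: "'a \<Rightarrow> 'a"

definition unit_space :: "'a groupoid \<Rightarrow> 'a topology" where
  "unit_space G = subtopology (arrows G) (units G)"

definition composable :: "'a groupoid \<Rightarrow> ('a \<times> 'a) set" where
  "composable G = {(g, h). g \<in> topspace (arrows G) \<and> h \<in> topspace (arrows G) \<and> src G g = rng G h}"

definition algebraic_groupoid :: "'a groupoid \<Rightarrow> bool" where
  "algebraic_groupoid G \<longleftrightarrow>
     units G \<subseteq> topspace (arrows G) \<and>
     (\<forall>u\<in>units G. rng G u = u \<and> src G u = u) \<and>
     (\<forall>g\<in>topspace (arrows G).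
        rng G g \<in> units G \<and> src G g \<in> units G \<and>
        mult G (rng G g) g = g \<and> mult G g (src G g) = g \<and>
        invert G g \<in> topspace (arrows G) \<and>
        rng G (invert G g) = src G g \<and> src G (invert G g) = rng G g \<and>
        mult G g (invert G g) = rng G g \<and> mult G (invert G g) g = src G g) \<and>
     (\<forall>(g, h)\<in>composable G.
        mult G g h \<in> topspace (arrows G) \<and>
        rng G (mult G g h) = rng G g \<and> src G (mult G g h) = src G h) \<and>
     (\<forall>g h k. (g, h) \<in> composable G \<and> (h, k) \<in> composable G \<longrightarrow>
        mult G (mult G g h) k = mult G g (mult G h k))"

definition topological_groupoid :: "'a groupoid \<Rightarrow> bool" where
  "topological_groupoid G \<longleftrightarrow>
     algebraic_groupoid G \<and>
     locally_compact_space (arrows G) \<and> Hausdorff_space (arrows G) \<and>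
     continuous_map (arrows G) (unit_space G) (rng G) \<and>
     continuous_map (arrows G) (unit_space G) (src G) \<and>
     continuous_map (subtopology (prod_topology (arrows G) (arrows G)) (composable G)) (arrows G)
       (\<lambda>(g, h). mult G g h) \<and>
     continuous_map (arrows G) (arrows G) (invert G)"

definition open_embedding_on :: "'a topology \<Rightarrow> 'b topology \<Rightarrow> 'a set \<Rightarrow> ('a \<Rightarrow> 'b) \<Rightarrow> bool" where
  "open_embedding_on X Y U f \<longleftrightarrow>
     openin X U \<and> openin Y (f ` U) \<and> homeomorphic_map (subtopology X U) (subtopology Y (f ` U)) f"

definition local_homeomorphism :: "'a topology \<Rightarrow> 'b topology \<Rightarrow> ('a \<Rightarrow> 'b) \<Rightarrow> bool" where
  "local_homeomorphism X Y f \<longleftrightarrow> (\<forall>p\<in>topspace X. \<exists>U. p \<in> U \<and> open_embedding_on X Y U f)"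

definition etale_groupoid :: "'a groupoid \<Rightarrow> bool" where
  "etale_groupoid G \<longleftrightarrow>
     topological_groupoid G \<and>
     local_homeomorphism (arrows G) (unit_space G) (rng G) \<and>
     local_homeomorphism (arrows G) (unit_space G) (src G)"

definition open_bisection :: "'a groupoid \<Rightarrow> 'a set \<Rightarrow> bool" where
  "open_bisection G B \<longleftrightarrow>
     open_embedding_on (arrows G) (unit_space G) B (rng G) \<and>
     open_embedding_on (arrows G) (unit_space G) B (src G)"


section \<open>Lie groupoids and smooth actions on the unit space\<close>

text \<open>Throughout, M0 is the smooth structure of the unit space and M that of the arrow space.\<close>

definition lie_groupoid :: "'a groupoid \<Rightarrow> 'a chart set \<Rightarrow> 'a chart set \<Rightarrow> bool" where
  "lie_groupoid G M0 M \<longleftrightarrow>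
     topological_groupoid G \<and> manifold (unit_space G) M0 \<and> manifold (arrows G) M \<and>
     smooth_embedding (unit_space G) M0 (arrows G) M (\<lambda>u. u) \<and>
     submersion (arrows G) M M0 (rng G) \<and> submersion (arrows G) M M0 (src G) \<and>
     smooth_map_on_subset (prod_manifold (arrows G) M (arrows G) M) M (composable G)
       (\<lambda>(g, h). mult G g h) \<and>
     smooth_map M M (topspace (arrows G)) (invert G)"

definition etale_lie_groupoid :: "'a groupoid \<Rightarrow> 'a chart set \<Rightarrow> 'a chart set \<Rightarrow> bool" where
  "etale_lie_groupoid G M0 M \<longleftrightarrow>
     lie_groupoid G M0 M \<and>
     local_diffeomorphism (arrows G) M (unit_space G) M0 (rng G) \<and>
     local_diffeomorphism (arrows G) M (unit_space G) M0 (src G)"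

definition bisection_acts_smoothly :: "'a groupoid \<Rightarrow> 'a chart set \<Rightarrow> 'a set \<Rightarrow> bool" where
  "bisection_acts_smoothly G M0 B \<longleftrightarrow>
     diffeomorphism M0 M0 (rng G ` B) (src G ` B) (src G \<circ> inv_into B (rng G))"

definition acts_smoothly :: "'a groupoid \<Rightarrow> 'a chart set \<Rightarrow> bool" where
  "acts_smoothly G M0 \<longleftrightarrow>
     (\<exists>\<B>. (\<forall>B\<in>\<B>. open_bisection G B \<and> bisection_acts_smoothly G M0 B) \<and>
          \<Union>\<B> = topspace (arrows G))"

definition bisection_atlas :: "'a groupoid \<Rightarrow> 'a chart set \<Rightarrow> 'a chart set" where
  "bisection_atlas G A =
     {(n, B, \<psi> \<circ> rng G) | n B W \<psi>. (n, W, \<psi>) \<in> A \<and> open_bisection G B \<and> rng G ` B \<subseteq> W}"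

end

theory Submission
  imports Defs
begin

text \<open>
  In an etale groupoid G, write r and s for the range and source map.  Everything rests on the fact that r
  determines the smooth structure: a structure for which r is a local diffeomorphism is generated by the
  charts pulled back along r from the unit space.  Concretely, if M is any structure that makes G an etale
  Lie groupoid, then the identity of G is locally a smooth inverse of r after r, in both directions between
  M and the structure generated by the bisection atlas.  Hence the two structures coincide
  (\<open>etale_lie_groupoid_unique\<close>), and the statement about the unique structure follows from the mere
  existence of one.

  If G is an etale Lie groupoid, then small bisections B are domains of diffeomorphisms for both r and s, and
  \<open>s \<circ> (r|B)\<^sup>-\<^sup>1\<close> is a diffeomorphism (\<open>etale_lie_groupoid_imp_acts_smoothly\<close>).

  Conversely, the bisection atlas always generates a smooth structure, since its transition maps
  are restrictions of those of the unit space, and for this structure r is a local diffeomorphism.  A map f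
  into G is then smooth as soon as it is continuous and \<open>r \<circ> f\<close> is smooth (\<open>smooth_map_via_rng\<close>).  This
  disposes of the structure maps: r is the identity on units; \<open>r (g\<^sup>-\<^sup>1) = s g\<close>, and s is a
  local diffeomorphism because on a bisection B that acts smoothly it is the action of B after r
  (\<open>src_local_diffeomorphism\<close>, the only place where smoothness of the action enters); finally
  \<open>r (g h) = r g\<close>, so that near a given product \<open>g h\<close> in a bisection B multiplication agrees with
  \<open>(g, h) \<mapsto> (r|B)\<^sup>-\<^sup>1 (r g)\<close>, which is smooth on an open set of pairs (\<open>mult_smooth\<close>).  Second
  countability of G is exactly what is left to make the structure a manifold.

  The conditions on differentials, for submersions and for the embedding of units, all come from local
  one-sided inverses and the chain rule (\<open>differential_left_inverse\<close>).  The chain rule itself is derived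
  from the mean value theorem (\<open>chain_rule_along_curve\<close>).
\<close>

section \<open>Calculus on open subsets of Cartesian spaces\<close>

lemma Euclidean_space_eq_top_of_set:
  "Euclidean_space n = top_of_set (topspace (Euclidean_space n))"
  by (simp add: Euclidean_space_def euclidean_product_topology)

lemma continuous_map_Euclidean_open:
  assumes "openin (Euclidean_space m) S"
  shows "continuous_map (subtopology (Euclidean_space m) S) euclideanreal f \<longleftrightarrow> continuous_on S f"
proof -
  have "subtopology (Euclidean_space m) S = top_of_set S"
    using openin_subset[OF assms]
    by (subst Euclidean_space_eq_top_of_set) (simp add: subtopology_subtopology inf.absorb2)
  then show ?thesis
    by simp
qed

text \<open>The cubical neighbourhoods contain each segment along which a single coordinate varies.  This is what
  the one-coordinate-at-a-time arguments below need.\<close>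

lemma openin_Euclidean_box:
  assumes "openin (Euclidean_space n) T" and "x \<in> T"
  obtains e where "e > 0"
    and "\<And>y. y \<in> topspace (Euclidean_space n) \<Longrightarrow> (\<And>i. i < n \<Longrightarrow> \<bar>y i - x i\<bar> < e) \<Longrightarrow> y \<in> T"
proof -
  obtain P where P: "openin (powertop_real UNIV) P" "T = P \<inter> topspace (Euclidean_space n)"
    using assms(1) by (auto simp: Euclidean_space_def openin_subtopology)
  have xE: "x \<in> topspace (Euclidean_space n)"
    using assms openin_subset by blast
  obtain U where U: "\<And>i. open (U i)" "x \<in> Pi\<^sub>E UNIV U" "Pi\<^sub>E UNIV U \<subseteq> P"
    using P(1) assms(2) P(2) unfolding openin_product_topology_alt by force
  have "\<exists>e>0. \<forall>t. \<bar>t - x i\<bar> < e \<longrightarrow> t \<in> U i" for i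
    using U(1)[of i] U(2) by (auto simp: open_real PiE_def)
  then obtain e where e: "\<And>i. e i > 0" "\<And>i t. \<bar>t - x i\<bar> < e i \<Longrightarrow> t \<in> U i"
    by metis
  define d where "d = Min (insert 1 (e ` {..<n}))"
  have d: "d > 0" "\<And>i. i < n \<Longrightarrow> d \<le> e i"
    unfolding d_def using e(1) by auto
  show ?thesis
  proof (rule that[OF d(1)])
    fix y assume y: "y \<in> topspace (Euclidean_space n)" "\<And>i. i < n \<Longrightarrow> \<bar>y i - x i\<bar> < d"
    have "y i \<in> U i" for i
    proof (cases "i < n")
      case True
      with y(2) d(2) e(2) show ?thesis by (meson less_le_trans)
    next
      case False
      then have "y i = x i"
        using y(1) xE by (simp add: topspace_Euclidean_space)
      then show ?thesis using U(2) by auto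
    qed
    then show "y \<in> T"
      using U(3) y(1) P(2) by auto
  qed
qed

lemma eventually_upd_in_open:
  assumes "openin (Euclidean_space n) S" "x \<in> S" "j < n"
  shows "\<forall>\<^sub>F t in nhds (x j). x(j := t) \<in> S"
proof -
  obtain e where e: "e > 0"
    "\<And>y. y \<in> topspace (Euclidean_space n) \<Longrightarrow> (\<And>i. i < n \<Longrightarrow> \<bar>y i - x i\<bar> < e) \<Longrightarrow> y \<in> S"
    using openin_Euclidean_box[OF assms(1,2)] by blast
  have "x \<in> topspace (Euclidean_space n)"
    using assms openin_subset by blast
  then have "x(j := t) \<in> S" if "dist t (x j) < e" for t
    using that e(1) assms(3) by (intro e(2)) (auto simp: dist_real_def topspace_Euclidean_space)
  then show ?thesis
    unfolding eventually_nhds_metric using e(1) by blast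
qed

text \<open>
  Partial derivatives with respect to one coordinate at a time suffice for a chain rule along a curve,
  provided that they are continuous: replace the coordinates of \<open>\<gamma> t0\<close> by those of \<open>\<gamma> t\<close> one after the
  other.  The mean value theorem controls each replacement.
\<close>

lemma chain_rule_along_curve:
  fixes g :: "(nat \<Rightarrow> real) \<Rightarrow> real" and \<gamma> :: "real \<Rightarrow> nat \<Rightarrow> real"
  assumes T: "openin (Euclidean_space n) T"
    and diff: "\<And>i y. i < n \<Longrightarrow> y \<in> T \<Longrightarrow> (\<lambda>t. g (y(i := t))) field_differentiable at (y i)"
    and cont: "\<And>i. i < n \<Longrightarrow> continuous_on T (partial_deriv i g)"
    and \<gamma>T: "\<forall>\<^sub>F t in nhds t0. \<gamma> t \<in> T"
    and d: "\<And>i. i < n \<Longrightarrow> ((\<lambda>t. \<gamma> t i) has_real_derivative d i) (at t0)"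
  shows "((\<lambda>t. g (\<gamma> t)) has_real_derivative (\<Sum>i<n. partial_deriv i g (\<gamma> t0) * d i)) (at t0)"
proof -
  have x0: "\<gamma> t0 \<in> T"
    using \<gamma>T by (rule eventually_nhds_x_imp_x)
  have x0E: "\<gamma> t0 \<in> topspace (Euclidean_space n)"
    using x0 T openin_subset by blast
  define mix where "mix k t = (\<lambda>i. if i < k then \<gamma> t i else \<gamma> t0 i)" for k :: nat and t
  have step: "((\<lambda>t. g (mix (Suc k) t) - g (mix k t)) has_real_derivative
      partial_deriv k g (\<gamma> t0) * d k) (at t0)" if k: "k < n" for k
  proof -
    define c where "c = partial_deriv k g (\<gamma> t0)"
    define u where "u t = g (mix (Suc k) t) - g (mix k t) - c * (\<gamma> t k - \<gamma> t0 k)" for t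
    (* Near the base point, the partial derivative in direction k differs from c by less than \<epsilon>, so the
       mean value theorem bounds the error of the linear approximation on the k-th replacement. *)
    have bound: "\<forall>\<^sub>F t in nhds t0. \<bar>u t\<bar> \<le> \<epsilon> * \<bar>\<gamma> t k - \<gamma> t0 k\<bar>" if "\<epsilon> > 0" for \<epsilon>
    proof -
      define T' where "T' = {y \<in> T. \<bar>partial_deriv k g y - c\<bar> < \<epsilon>}"
      have "openin (top_of_set T) (T \<inter> partial_deriv k g -` ball c \<epsilon>)"
        using cont[OF k] by (intro continuous_openin_preimage_gen) auto
      moreover have "T \<inter> partial_deriv k g -` ball c \<epsilon> = T'"
        by (auto simp: T'_def dist_real_def abs_minus_commute)
      ultimately have "openin (Euclidean_space n) T'"
        using T Euclidean_space_eq_top_of_set[of n] openin_trans by metis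
      moreover have "\<gamma> t0 \<in> T'"
        using x0 that by (simp add: T'_def c_def)
      ultimately obtain e where e: "e > 0"
        "\<And>y. y \<in> topspace (Euclidean_space n) \<Longrightarrow> (\<And>i. i < n \<Longrightarrow> \<bar>y i - \<gamma> t0 i\<bar> < e) \<Longrightarrow> y \<in> T'"
        using openin_Euclidean_box by blast
      have "\<forall>\<^sub>F t in nhds t0. \<bar>\<gamma> t i - \<gamma> t0 i\<bar> < e" if "i < n" for i
      proof -
        have "((\<lambda>t. \<gamma> t i) \<longlongrightarrow> \<gamma> t0 i) (nhds t0)"
          using DERIV_isCont[OF d[OF that]] by (simp add: isCont_def tendsto_nhds_iff)
        from tendstoD[OF this e(1)] show ?thesis
          by (simp add: dist_real_def)
      qed
      then have "\<forall>\<^sub>F t in nhds t0. \<forall>i\<in>{..<n}. \<bar>\<gamma> t i - \<gamma> t0 i\<bar> < e"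
        by (intro eventually_ball_finite) auto
      then show ?thesis
      proof (rule eventually_mono)
        fix t assume t: "\<forall>i\<in>{..<n}. \<bar>\<gamma> t i - \<gamma> t0 i\<bar> < e"
        define y where "y = mix k t"
        let ?I = "closed_segment (\<gamma> t0 k) (\<gamma> t k)"
        have inT': "y(k := s) \<in> T'" if s: "s \<in> ?I" for s
        proof (rule e(2))
          show "y(k := s) \<in> topspace (Euclidean_space n)"
            using x0E k by (auto simp: topspace_Euclidean_space y_def mix_def)
          have "\<bar>s - \<gamma> t0 k\<bar> \<le> \<bar>\<gamma> t k - \<gamma> t0 k\<bar>"
            using s by (auto simp: closed_segment_eq_real_ivl split: if_splits)
          then show "\<bar>(y(k := s)) i - \<gamma> t0 i\<bar> < e" if "i < n" for i
            using t that k e(1) by (force simp: y_def mix_def)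
        qed
        have der: "((\<lambda>s. g (y(k := s)) - c * s) has_field_derivative
            partial_deriv k g (y(k := s)) - c) (at s within ?I)" if s: "s \<in> ?I" for s
        proof -
          have "(\<lambda>r. g ((y(k := s))(k := r))) field_differentiable at ((y(k := s)) k)"
            using inT'[OF s] by (intro diff k) (auto simp: T'_def)
          then have "((\<lambda>r. g (y(k := r))) has_field_derivative partial_deriv k g (y(k := s))) (at s)"
            by (simp add: partial_deriv_def field_differentiable_derivI)
          then show ?thesis
            by (auto intro!: derivative_eq_intros intro: DERIV_subset)
        qed
        have "norm ((g (y(k := \<gamma> t k)) - c * \<gamma> t k) - (g (y(k := \<gamma> t0 k)) - c * \<gamma> t0 k))
            \<le> \<epsilon> * norm (\<gamma> t k - \<gamma> t0 k)"
          using inT' by (intro field_differentiable_bound[where S = ?I, OF _ der])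
            (auto simp: T'_def intro: less_imp_le)
        moreover have "y(k := \<gamma> t k) = mix (Suc k) t" "y(k := \<gamma> t0 k) = mix k t"
          by (auto simp: y_def mix_def fun_eq_iff)
        ultimately show "\<bar>u t\<bar> \<le> \<epsilon> * \<bar>\<gamma> t k - \<gamma> t0 k\<bar>"
          by (simp add: u_def algebra_simps)
      qed
    qed
    have u0: "u t0 = 0"
      by (simp add: u_def mix_def)
    have "((\<lambda>t. (u t - u t0) / (t - t0)) \<longlongrightarrow> 0) (at t0)"
    proof (rule tendstoI)
      fix \<eta> :: real assume \<eta>: "\<eta> > 0"
      define \<epsilon> where "\<epsilon> = \<eta> / (\<bar>d k\<bar> + 1)"
      have \<epsilon>: "\<epsilon> > 0" "\<epsilon> * (\<bar>d k\<bar> + 1) = \<eta>"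
        using \<eta> by (simp_all add: \<epsilon>_def add_nonneg_pos)
      have "((\<lambda>t. \<bar>(\<gamma> t k - \<gamma> t0 k) / (t - t0)\<bar>) \<longlongrightarrow> \<bar>d k\<bar>) (at t0)"
        using d[OF k] by (intro tendsto_rabs) (simp add: has_field_derivative_iff)
      then have "\<forall>\<^sub>F t in at t0. \<bar>(\<gamma> t k - \<gamma> t0 k) / (t - t0)\<bar> < \<bar>d k\<bar> + 1"
        by (rule order_tendstoD) simp
      moreover have "\<forall>\<^sub>F t in at t0. \<bar>u t\<bar> \<le> \<epsilon> * \<bar>\<gamma> t k - \<gamma> t0 k\<bar>"
        using bound[OF \<epsilon>(1)] by (simp add: eventually_nhds_conv_at)
      moreover have "\<forall>\<^sub>F t in at t0. t \<noteq> t0"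
        by (simp add: eventually_at_filter)
      ultimately show "\<forall>\<^sub>F t in at t0. dist ((u t - u t0) / (t - t0)) 0 < \<eta>"
      proof eventually_elim
        case (elim t)
        have "\<bar>u t\<bar> / \<bar>t - t0\<bar> \<le> \<epsilon> * \<bar>\<gamma> t k - \<gamma> t0 k\<bar> / \<bar>t - t0\<bar>"
          using elim by (intro divide_right_mono) auto
        also have "\<dots> = \<epsilon> * \<bar>(\<gamma> t k - \<gamma> t0 k) / (t - t0)\<bar>"
          by simp
        also have "\<dots> < \<epsilon> * (\<bar>d k\<bar> + 1)"
          using elim \<epsilon> by (intro mult_strict_left_mono) auto
        finally show ?case
          using \<epsilon> u0 by (simp add: dist_real_def)
      qed
    qed
    then have "(u has_real_derivative 0) (at t0)"
      by (simp add: has_field_derivative_iff)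
    moreover have "((\<lambda>t. c * (\<gamma> t k - \<gamma> t0 k)) has_real_derivative c * d k) (at t0)"
      using d[OF k] by (auto intro!: derivative_eq_intros)
    ultimately have "((\<lambda>t. u t + c * (\<gamma> t k - \<gamma> t0 k)) has_real_derivative 0 + c * d k) (at t0)"
      by (rule DERIV_add)
    then show ?thesis
      by (simp add: u_def c_def)
  qed
  have "((\<lambda>t. g (mix k t)) has_real_derivative (\<Sum>i<k. partial_deriv i g (\<gamma> t0) * d i)) (at t0)"
    if "k \<le> n" for k
    using that
  proof (induction k)
    case 0
    then show ?case by (simp add: mix_def)
  next
    case (Suc k)
    then show ?case
      using DERIV_add[OF Suc.IH step[of k]] by (simp add: add.commute)
  qed
  then have "((\<lambda>t. g (mix n t)) has_real_derivative (\<Sum>i<n. partial_deriv i g (\<gamma> t0) * d i)) (at t0)"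
    by simp
  moreover have "\<forall>\<^sub>F t in nhds t0. g (mix n t) = g (\<gamma> t)"
    using \<gamma>T
  proof eventually_elim
    case (elim t)
    then have "\<gamma> t \<in> topspace (Euclidean_space n)"
      using T openin_subset by blast
    then have "mix n t = \<gamma> t"
      using x0E by (auto simp: mix_def topspace_Euclidean_space fun_eq_iff)
    then show ?case by simp
  qed
  ultimately show ?thesis
    by (rule DERIV_cong_ev[OF refl _ refl, THEN iffD1, rotated])
qed

lemma Ck_on_imp_continuous_on:
  assumes "openin (Euclidean_space m) S" and "Ck_on k m S f"
  shows "continuous_on S f"
  using assms by (cases k) (simp_all add: continuous_map_Euclidean_open)

text \<open>On an open set, the recursive clause can be phrased with \<^term>\<open>continuous_on\<close> and with explicit
  derivatives, which the rules of differentiation produce directly.\<close>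

lemma Ck_on_Suc_iff:
  assumes "openin (Euclidean_space m) S"
  shows "Ck_on (Suc k) m S f \<longleftrightarrow> continuous_on S f \<and>
     (\<forall>j<m. (\<forall>x\<in>S. ((\<lambda>t. f (x(j := t))) has_real_derivative partial_deriv j f x) (at (x j))) \<and>
            Ck_on k m S (partial_deriv j f))"
  using assms by (auto simp: continuous_map_Euclidean_open partial_deriv_def
      field_differentiable_derivI field_differentiable_def DERIV_imp_deriv)

lemma Ck_on_0_iff:
  "openin (Euclidean_space m) S \<Longrightarrow> Ck_on 0 m S f \<longleftrightarrow> continuous_on S f"
  by (simp add: continuous_map_Euclidean_open)

declare Ck_on.simps [simp del]

lemma Ck_on_SucD: "Ck_on (Suc k) m S f \<Longrightarrow> Ck_on k m S f"
  by (induction k arbitrary: f) (auto simp: Ck_on.simps)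

lemma Ck_on_subset:
  assumes "openin (Euclidean_space m) S" "openin (Euclidean_space m) S'" "S' \<subseteq> S"
  shows "Ck_on k m S f \<Longrightarrow> Ck_on k m S' f"
proof (induction k arbitrary: f)
  case 0
  then show ?case
    using assms by (auto simp: Ck_on_0_iff intro: continuous_on_subset)
next
  case (Suc k)
  then show ?case
    using assms by (auto simp: Ck_on_Suc_iff intro: continuous_on_subset)
qed

lemma partial_deriv_cong_open:
  assumes "openin (Euclidean_space m) S" "x \<in> S" "j < m" "\<And>y. y \<in> S \<Longrightarrow> f y = g y"
  shows "partial_deriv j f x = partial_deriv j g x"
  unfolding partial_deriv_def
  using eventually_upd_in_open[OF assms(1-3)]
  by (intro deriv_cong_ev refl) (auto elim: eventually_mono simp: assms(4))

lemma Ck_on_cong: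
  assumes "openin (Euclidean_space m) S"
  shows "(\<And>y. y \<in> S \<Longrightarrow> f y = g y) \<Longrightarrow> Ck_on k m S f \<Longrightarrow> Ck_on k m S g"
proof (induction k arbitrary: f g)
  case 0
  then show ?case
    using assms continuous_on_cong[OF refl, of S f g] by (auto simp: Ck_on_0_iff)
next
  case (Suc k)
  have pd: "partial_deriv j f x = partial_deriv j g x" if "x \<in> S" "j < m" for x j
    using assms that Suc.prems(1) by (rule partial_deriv_cong_open)
  have "((\<lambda>t. g (x(j := t))) has_real_derivative partial_deriv j g x) (at (x j))"
    if "x \<in> S" "j < m" for x j
  proof -
    have "((\<lambda>t. f (x(j := t))) has_real_derivative partial_deriv j g x) (at (x j))"
      using Suc.prems(2) that pd assms by (auto simp: Ck_on_Suc_iff)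
    moreover have "\<forall>\<^sub>F t in nhds (x j). f (x(j := t)) = g (x(j := t))"
      using eventually_upd_in_open[OF assms that] by (rule eventually_mono) (rule Suc.prems(1))
    ultimately show ?thesis
      by (rule DERIV_cong_ev[OF refl _ refl, THEN iffD1, rotated])
  qed
  moreover have "Ck_on k m S (partial_deriv j g)" if "j < m" for j
  proof (rule Suc.IH)
    show "partial_deriv j f y = partial_deriv j g y" if "y \<in> S" for y
      using that \<open>j < m\<close> by (rule pd)
    show "Ck_on k m S (partial_deriv j f)"
      using Suc.prems(2) \<open>j < m\<close> assms by (simp add: Ck_on_Suc_iff)
  qed
  moreover have "continuous_on S g"
    using Suc.prems assms continuous_on_cong[OF refl, of S f g] by (auto simp: Ck_on_Suc_iff)
  ultimately show ?case
    using assms by (simp add: Ck_on_Suc_iff)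
qed

lemma Ck_on_SucI:
  assumes S: "openin (Euclidean_space m) S" and "continuous_on S f"
    and der: "\<And>j x. j < m \<Longrightarrow> x \<in> S \<Longrightarrow> ((\<lambda>t. f (x(j := t))) has_real_derivative f' j x) (at (x j))"
    and "\<And>j. j < m \<Longrightarrow> Ck_on k m S (f' j)"
  shows "Ck_on (Suc k) m S f"
proof -
  have eq: "partial_deriv j f x = f' j x" if "j < m" "x \<in> S" for j x
    unfolding partial_deriv_def by (rule DERIV_imp_deriv[OF der[OF that]])
  have "Ck_on k m S (partial_deriv j f)" if "j < m" for j
    by (rule Ck_on_cong[OF S _ assms(4)[OF that]]) (simp add: eq that)
  then show ?thesis
    using assms by (auto simp: Ck_on_Suc_iff eq)
qed

lemma continuous_on_open_local:
  assumes S: "openin (Euclidean_space m) S"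
    and loc: "\<And>x. x \<in> S \<Longrightarrow> \<exists>S'. x \<in> S' \<and> S' \<subseteq> S \<and> openin (Euclidean_space m) S' \<and> continuous_on S' f"
  shows "continuous_on S f"
  unfolding continuous_on_eq_continuous_within
proof
  fix x assume x: "x \<in> S"
  obtain S' where S': "x \<in> S'" "S' \<subseteq> S" "openin (Euclidean_space m) S'" "continuous_on S' f"
    using loc[OF x] by blast
  obtain P where P: "open P" "S' = topspace (Euclidean_space m) \<inter> P"
    using S'(3) Euclidean_space_eq_top_of_set[of m] openin_open by metis
  have "at x within S = at x within S'"
    using S' P openin_subset[OF S] by (intro at_within_nhd[of x P]) auto
  then show "continuous (at x within S) f"
    using S' by (simp add: continuous_on_eq_continuous_within)
qed

lemma Ck_on_local:
  assumes S: "openin (Euclidean_space m) S"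
  shows "(\<And>x. x \<in> S \<Longrightarrow> \<exists>S'. x \<in> S' \<and> S' \<subseteq> S \<and> openin (Euclidean_space m) S' \<and> Ck_on k m S' f)
    \<Longrightarrow> Ck_on k m S f"
proof (induction k arbitrary: f)
  case 0
  have "continuous_on S f"
    using "0.prems" by (intro continuous_on_open_local[OF S]) (metis Ck_on_imp_continuous_on)
  then show ?case
    using S by (simp add: Ck_on_0_iff)
next
  case (Suc k)
  have "((\<lambda>t. f (x(j := t))) has_real_derivative partial_deriv j f x) (at (x j))"
    if "x \<in> S" "j < m" for x j
    using Suc.prems[OF that(1)] that(2) by (auto simp: Ck_on_Suc_iff)
  moreover have "Ck_on k m S (partial_deriv j f)" if "j < m" for j
  proof (rule Suc.IH)
    fix x assume "x \<in> S"
    from Suc.prems[OF this] that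
    show "\<exists>S'. x \<in> S' \<and> S' \<subseteq> S \<and> openin (Euclidean_space m) S' \<and> Ck_on k m S' (partial_deriv j f)"
      by (metis Ck_on_Suc_iff)
  qed
  moreover have "continuous_on S f"
    using Suc.prems by (intro continuous_on_open_local[OF S]) (metis Ck_on_imp_continuous_on)
  ultimately show ?case
    using S by (simp add: Ck_on_Suc_iff)
qed

lemma Ck_on_const: "openin (Euclidean_space m) S \<Longrightarrow> Ck_on k m S (\<lambda>x. c)"
proof (induction k arbitrary: c)
  case (Suc k)
  then show ?case
    by (intro Ck_on_SucI[where f' = "\<lambda>_ _. 0"]) (auto simp: Ck_on_0_iff)
qed (simp add: Ck_on_0_iff)

lemma continuous_on_coordinate: "continuous_on S (\<lambda>x :: nat \<Rightarrow> real. x i)"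
  by (rule continuous_on_subset[OF continuous_on_product_coordinates]) simp

lemma Ck_on_coordinate: "openin (Euclidean_space m) S \<Longrightarrow> Ck_on k m S (\<lambda>x. x i)"
proof (cases k)
  case (Suc l)
  assume S: "openin (Euclidean_space m) S"
  have "((\<lambda>t. (x(j := t)) i) has_real_derivative of_bool (i = j)) (at (x j))" for x :: "nat \<Rightarrow> real" and j
    by (cases "i = j") auto
  then show ?thesis
    unfolding Suc using S
    by (intro Ck_on_SucI[where f' = "\<lambda>j _. of_bool (i = j)"] Ck_on_const continuous_on_coordinate) auto
qed (auto simp: Ck_on_0_iff intro: continuous_on_coordinate)

lemma Ck_on_add:
  assumes S: "openin (Euclidean_space m) S"
  shows "Ck_on k m S f \<Longrightarrow> Ck_on k m S g \<Longrightarrow> Ck_on k m S (\<lambda>x. f x + g x)"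
proof (induction k arbitrary: f g)
  case 0
  then show ?case using S by (auto simp: Ck_on_0_iff intro: continuous_intros)
next
  case (Suc k)
  have "((\<lambda>t. f (x(j := t)) + g (x(j := t))) has_real_derivative
      partial_deriv j f x + partial_deriv j g x) (at (x j))"
    if "j < m" "x \<in> S" for j x
    using DERIV_add[of "\<lambda>t. f (x(j := t))" "partial_deriv j f x" "x j" UNIV
        "\<lambda>t. g (x(j := t))" "partial_deriv j g x"] Suc.prems S that
    by (simp add: Ck_on_Suc_iff)
  then show ?case
  proof (rule Ck_on_SucI[OF S, rotated])
    show "continuous_on S (\<lambda>x. f x + g x)"
      using S Suc.prems by (simp add: Ck_on_Suc_iff continuous_on_add)
    show "Ck_on k m S (\<lambda>x. partial_deriv j f x + partial_deriv j g x)" if "j < m" for j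
      using S Suc.prems that by (intro Suc.IH) (simp_all add: Ck_on_Suc_iff)
  qed
qed

lemma Ck_on_mult:
  assumes S: "openin (Euclidean_space m) S"
  shows "Ck_on k m S f \<Longrightarrow> Ck_on k m S g \<Longrightarrow> Ck_on k m S (\<lambda>x. f x * g x)"
proof (induction k arbitrary: f g)
  case 0
  then show ?case using S by (auto simp: Ck_on_0_iff intro: continuous_intros)
next
  case (Suc k)
  have lower: "Ck_on k m S f" "Ck_on k m S g"
    using Suc.prems by (auto intro: Ck_on_SucD)
  have "((\<lambda>t. f (x(j := t)) * g (x(j := t))) has_real_derivative
      partial_deriv j f x * g x + partial_deriv j g x * f x) (at (x j))"
    if "j < m" "x \<in> S" for j x
    using DERIV_mult[of "\<lambda>t. f (x(j := t))" "partial_deriv j f x" "x j" UNIV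
        "\<lambda>t. g (x(j := t))" "partial_deriv j g x"] Suc.prems S that
    by (simp add: Ck_on_Suc_iff)
  then show ?case
  proof (rule Ck_on_SucI[OF S, rotated])
    show "continuous_on S (\<lambda>x. f x * g x)"
      using S Suc.prems by (simp add: Ck_on_Suc_iff continuous_on_mult)
    show "Ck_on k m S (\<lambda>x. partial_deriv j f x * g x + partial_deriv j g x * f x)" if "j < m" for j
      using S Suc.prems that lower by (intro Ck_on_add Suc.IH) (simp_all add: Ck_on_Suc_iff)
  qed
qed

lemma Ck_on_sum:
  assumes S: "openin (Euclidean_space m) S" and "\<And>i. i \<in> I \<Longrightarrow> Ck_on k m S (f i)"
  shows "Ck_on k m S (\<lambda>x. \<Sum>i\<in>I. f i x)"
  using assms(2)
proof (induction I rule: infinite_finite_induct)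
  case (insert i I)
  then show ?case by (simp add: Ck_on_add S)
qed (simp_all add: Ck_on_const S)

lemma has_derivative_compose_partial:
  assumes S: "openin (Euclidean_space m) S" and T: "openin (Euclidean_space n) T"
    and FT: "F ` S \<subseteq> T" and F: "\<And>i. i < n \<Longrightarrow> Ck_on (Suc 0) m S (\<lambda>x. F x i)"
    and g: "Ck_on (Suc 0) n T g" and x: "x \<in> S" and j: "j < m"
  shows "((\<lambda>t. g (F (x(j := t)))) has_real_derivative
      (\<Sum>i<n. partial_deriv i g (F x) * partial_deriv j (\<lambda>y. F y i) x)) (at (x j))"
proof -
  have "((\<lambda>t. g (F (x(j := t)))) has_real_derivative
      (\<Sum>i<n. partial_deriv i g (F (x(j := x j))) * partial_deriv j (\<lambda>y. F y i) x)) (at (x j))"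
  proof (rule chain_rule_along_curve[OF T])
    fix i assume i: "i < n"
    show "(\<lambda>t. g (y(i := t))) field_differentiable at (y i)" if "y \<in> T" for y
      using g T i that by (auto simp: Ck_on_Suc_iff field_differentiable_def)
    show "continuous_on T (partial_deriv i g)"
      using g T i by (auto simp: Ck_on_Suc_iff Ck_on_0_iff)
    show "((\<lambda>t. F (x(j := t)) i) has_real_derivative partial_deriv j (\<lambda>y. F y i) x) (at (x j))"
      using F[OF i] S x j by (auto simp: Ck_on_Suc_iff)
  next
    show "\<forall>\<^sub>F t in nhds (x j). F (x(j := t)) \<in> T"
      using eventually_upd_in_open[OF S x j] by (rule eventually_mono) (use FT in blast)
  qed
  then show ?thesis by simp
qed

lemma continuous_on_Euclidean_valued:
  assumes "F ` S \<subseteq> topspace (Euclidean_space n)" and "\<And>i. i < n \<Longrightarrow> continuous_on S (\<lambda>x. F x i)"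
  shows "continuous_on S F"
proof (rule continuous_on_coordinatewise_then_product)
  fix i
  show "continuous_on S (\<lambda>x. F x i)"
  proof (cases "i < n")
    case False
    then have "\<And>x. x \<in> S \<Longrightarrow> F x i = 0"
      using assms(1) by (auto simp: topspace_Euclidean_space)
    then show ?thesis
      using continuous_on_cong[OF refl, of S "\<lambda>x. F x i" "\<lambda>_. 0"] by simp
  qed (rule assms(2))
qed

text \<open>Induction on k: by the chain rule, the partial derivatives of the composition are sums of products of
  partial derivatives, and these involve the outer function only through compositions of lower order.\<close>

lemma Ck_on_compose:
  assumes S: "openin (Euclidean_space m) S" and T: "openin (Euclidean_space n) T"
    and FT: "F ` S \<subseteq> T" and F: "\<And>i k. i < n \<Longrightarrow> Ck_on k m S (\<lambda>x. F x i)"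
  shows "Ck_on k n T g \<Longrightarrow> Ck_on k m S (\<lambda>x. g (F x))"
proof (induction k arbitrary: g)
  have "F ` S \<subseteq> topspace (Euclidean_space n)"
    using FT openin_subset[OF T] by blast
  then have contF: "continuous_on S F"
    using Ck_on_imp_continuous_on[OF S F] by (rule continuous_on_Euclidean_valued)
  have cont: "continuous_on S (\<lambda>x. g (F x))" if "continuous_on T g" for g :: "_ \<Rightarrow> real"
    using that contF FT by (rule continuous_on_compose2)
  {
    case 0
    then show ?case using S T cont by (auto simp: Ck_on_0_iff)
  next
    case (Suc k)
    have "Ck_on (Suc 0) n T g"
      using Suc.prems by (induction k) (auto intro: Ck_on_SucD)
    from has_derivative_compose_partial[OF S T FT F this]
    show ?case
    proof (rule Ck_on_SucI[OF S, rotated])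
      show "continuous_on S (\<lambda>x. g (F x))"
        using T Suc.prems by (intro cont) (simp add: Ck_on_Suc_iff)
      show "Ck_on k m S (\<lambda>x. \<Sum>i<n. partial_deriv i g (F x) * partial_deriv j (\<lambda>y. F y i) x)"
        if "j < m" for j
        using S T Suc.prems F[of _ "Suc k"] that
        by (intro Ck_on_sum Ck_on_mult Suc.IH) (simp_all add: Ck_on_Suc_iff)
    qed
  }
qed

lemma smooth_on_openD: "smooth_on m S n F \<Longrightarrow> openin (Euclidean_space m) S"
  and smooth_on_imageD: "smooth_on m S n F \<Longrightarrow> F ` S \<subseteq> topspace (Euclidean_space n)"
  and smooth_on_CkD: "smooth_on m S n F \<Longrightarrow> i < n \<Longrightarrow> Ck_on k m S (\<lambda>x. F x i)"
  by (auto simp: smooth_on_def)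

lemma smooth_on_imp_continuous_on: "smooth_on m S n F \<Longrightarrow> continuous_on S F"
  by (rule continuous_on_Euclidean_valued[OF smooth_on_imageD])
    (auto intro: Ck_on_imp_continuous_on[OF smooth_on_openD smooth_on_CkD[where k = 0]])

lemma smooth_on_compose:
  assumes "smooth_on m S n F" "smooth_on n T p H" "F ` S \<subseteq> T"
  shows "smooth_on m S p (H \<circ> F)"
  unfolding smooth_on_def
proof (intro conjI allI impI)
  show "Ck_on k m S (\<lambda>x. (H \<circ> F) x i)" if "i < p" for i k
    using Ck_on_compose[OF smooth_on_openD[OF assms(1)] smooth_on_openD[OF assms(2)] assms(3)
        smooth_on_CkD[OF assms(1)] smooth_on_CkD[OF assms(2) that]]
    by simp
  show "openin (Euclidean_space m) S"
    using assms(1) by (rule smooth_on_openD)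
  show "(H \<circ> F) ` S \<subseteq> topspace (Euclidean_space p)"
    using assms(3) smooth_on_imageD[OF assms(2)] by (auto simp: image_subset_iff)
qed

lemma smooth_on_subset:
  "smooth_on m S n F \<Longrightarrow> openin (Euclidean_space m) S' \<Longrightarrow> S' \<subseteq> S \<Longrightarrow> smooth_on m S' n F"
  unfolding smooth_on_def by (auto intro: Ck_on_subset)

lemma smooth_on_cong:
  assumes "smooth_on m S n F" "\<And>x. x \<in> S \<Longrightarrow> F x = H x"
  shows "smooth_on m S n H"
  unfolding smooth_on_def
proof (intro conjI allI impI)
  show "Ck_on k m S (\<lambda>x. H x i)" if "i < n" for i k
    using assms(2) by (intro Ck_on_cong[OF smooth_on_openD[OF assms(1)] _ smooth_on_CkD[OF assms(1) that]]) simp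
qed (use assms in \<open>auto simp: smooth_on_def\<close>)

lemma smooth_on_local:
  assumes "\<And>x. x \<in> S \<Longrightarrow> \<exists>S'. x \<in> S' \<and> S' \<subseteq> S \<and> smooth_on m S' n F"
  shows "smooth_on m S n F"
proof -
  have op: "openin (Euclidean_space m) S"
    by (subst openin_subopen) (metis assms smooth_on_openD)
  show ?thesis
    unfolding smooth_on_def
  proof (intro conjI allI impI op)
    show "F ` S \<subseteq> topspace (Euclidean_space n)"
      using assms smooth_on_imageD by blast
    show "Ck_on k m S (\<lambda>x. F x i)" if "i < n" for i k
      using assms smooth_on_openD smooth_on_CkD[OF _ that] by (intro Ck_on_local[OF op]) metis
  qed
qed

lemma smooth_on_id: "openin (Euclidean_space m) S \<Longrightarrow> smooth_on m S m (\<lambda>x. x)"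
  by (auto simp: smooth_on_def Ck_on_coordinate dest: openin_subset)

lemma differential_compose:
  assumes F: "smooth_on m S n F" and H: "smooth_on n T p H" and FT: "F ` S \<subseteq> T" and x: "x \<in> S"
  shows "differential m p (H \<circ> F) x v = differential n p H (F x) (differential m n F x v)"
proof
  fix i
  show "differential m p (H \<circ> F) x v i = differential n p H (F x) (differential m n F x v) i"
  proof (cases "i < p")
    case True
    have "partial_deriv j (\<lambda>y. (H \<circ> F) y i) x =
        (\<Sum>l<n. partial_deriv l (\<lambda>y. H y i) (F x) * partial_deriv j (\<lambda>y. F y l) x)" if "j < m" for j
      using has_derivative_compose_partial[OF smooth_on_openD[OF F] smooth_on_openD[OF H] FT
          smooth_on_CkD[OF F] smooth_on_CkD[OF H True] x that]
      by (simp add: partial_deriv_def[of j "\<lambda>y. H (F y) i"] DERIV_imp_deriv)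
    then have "differential m p (H \<circ> F) x v i =
        (\<Sum>j<m. \<Sum>l<n. partial_deriv l (\<lambda>y. H y i) (F x) * partial_deriv j (\<lambda>y. F y l) x * v j)"
      using True by (simp add: differential_def sum_distrib_right)
    also have "\<dots> = differential n p H (F x) (differential m n F x v) i"
      using True by (subst sum.swap) (simp add: differential_def sum_distrib_left mult.assoc)
    finally show ?thesis .
  qed (simp add: differential_def)
qed

lemma differential_identity_near:
  assumes S: "openin (Euclidean_space m) S" and x: "x \<in> S" and "\<And>y. y \<in> S \<Longrightarrow> F y = y"
    and v: "v \<in> topspace (Euclidean_space m)"
  shows "differential m m F x v = v"
proof
  fix i
  have "partial_deriv j (\<lambda>y. F y i) x = of_bool (i = j)" if "j < m" for j
  proof -
    have "partial_deriv j (\<lambda>y. F y i) x = partial_deriv j (\<lambda>y. y i) x"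
      using S x that assms(3) by (intro partial_deriv_cong_open[of m S]) auto
    also have "\<dots> = of_bool (i = j)"
      by (cases "i = j") (auto simp: partial_deriv_def)
    finally show ?thesis .
  qed
  then show "differential m m F x v i = v i"
    using v by (auto simp: differential_def topspace_Euclidean_space if_distrib cong: if_cong)
qed

lemma differential_in_Euclidean: "differential m n F x v \<in> topspace (Euclidean_space n)"
  by (simp add: differential_def topspace_Euclidean_space)


section \<open>Charts and smooth structures\<close>

lemma inv_into_subset_eq:
  "inj_on \<phi> U \<Longrightarrow> W \<subseteq> U \<Longrightarrow> y \<in> \<phi> ` W \<Longrightarrow> inv_into W \<phi> y = inv_into U \<phi> y"
  by (metis (no_types, lifting) imageE inj_on_subset inv_into_f_f subsetD)

text \<open>A chart is an open embedding into a Cartesian space, and an open bisection is an open set on which r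
  and s are open embeddings into the unit space.  The following facts therefore serve both.\<close>

lemma open_embedding_on_openD: "open_embedding_on X Y U f \<Longrightarrow> openin X U"
  and open_embedding_on_image_openD: "open_embedding_on X Y U f \<Longrightarrow> openin Y (f ` U)"
  by (simp_all add: open_embedding_on_def)

lemma open_embedding_on_inj_onD:
  assumes "open_embedding_on X Y U f"
  shows "inj_on f U"
  using assms homeomorphic_imp_injective_map[of "subtopology X U" "subtopology Y (f ` U)" f]
    openin_subset[OF open_embedding_on_openD[OF assms]]
  by (simp add: open_embedding_on_def inf.absorb2)

lemma open_embedding_on_continuousD:
  "open_embedding_on X Y U f \<Longrightarrow> continuous_map (subtopology X U) (subtopology Y (f ` U)) f"
  by (simp add: open_embedding_on_def homeomorphic_imp_continuous_map)

lemma open_embedding_on_image_open: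
  assumes f: "open_embedding_on X Y U f" and W: "openin X W" "W \<subseteq> U"
  shows "openin Y (f ` W)"
proof -
  have "openin (subtopology X U) W"
    using f W by (simp add: open_embedding_on_def openin_open_subtopology)
  moreover have "open_map (subtopology X U) (subtopology Y (f ` U)) f"
    using f by (simp add: open_embedding_on_def homeomorphic_imp_open_map)
  ultimately have "openin (subtopology Y (f ` U)) (f ` W)"
    by (simp add: open_map_def)
  then show ?thesis
    using f by (simp add: open_embedding_on_def openin_open_subtopology)
qed

lemma open_embedding_on_subset:
  assumes f: "open_embedding_on X Y U f" and W: "openin X W" "W \<subseteq> U"
  shows "open_embedding_on X Y W f"
proof -
  have "homeomorphic_map (subtopology (subtopology X U) W)
      (subtopology (subtopology Y (f ` U)) (f ` W)) f"
  proof (rule homeomorphic_map_subtopologies)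
    show "homeomorphic_map (subtopology X U) (subtopology Y (f ` U)) f"
      using f by (simp add: open_embedding_on_def)
    show "f ` (topspace (subtopology X U) \<inter> W) = topspace (subtopology Y (f ` U)) \<inter> f ` W"
      using openin_subset[OF open_embedding_on_image_open[OF assms]] openin_subset[OF W(1)] W(2) by auto
  qed
  then show ?thesis
    using W open_embedding_on_image_open[OF assms]
    by (simp add: open_embedding_on_def subtopology_subtopology inf.absorb2 image_mono)
qed

lemma open_embedding_on_compose:
  assumes f: "open_embedding_on X Y U f" and g: "open_embedding_on Y Z V g" and "f ` U \<subseteq> V"
  shows "open_embedding_on X Z U (g \<circ> f)"
proof -
  have "open_embedding_on Y Z (f ` U) g"
    using g open_embedding_on_image_openD[OF f] assms(3) by (rule open_embedding_on_subset)
  with f show ?thesis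
    unfolding open_embedding_on_def image_comp[symmetric] by (blast intro: homeomorphic_map_compose)
qed

lemma open_embedding_on_inv_continuous:
  assumes f: "open_embedding_on X Y U f"
  shows "continuous_map (subtopology Y (f ` U)) X (inv_into U f)"
proof -
  have "homeomorphic_map (subtopology X U) (subtopology Y (f ` U)) f"
    using f by (simp add: open_embedding_on_def)
  then obtain g where g: "homeomorphic_maps (subtopology X U) (subtopology Y (f ` U)) f g"
    unfolding homeomorphic_map_maps by blast
  have top: "topspace (subtopology X U) = U"
    using openin_subset[OF open_embedding_on_openD[OF f]] by auto
  have cont: "continuous_map (subtopology Y (f ` U)) X g"
    using g by (simp add: homeomorphic_maps_def continuous_map_in_subtopology)
  have "g y = inv_into U f y" if "y \<in> topspace (subtopology Y (f ` U))" for y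
    using g that top open_embedding_on_inj_onD[OF f] by (auto simp: homeomorphic_maps_def inv_into_f_f)
  with cont show ?thesis
    by (rule continuous_map_eq)
qed

lemma is_chart_iff_open_embedding:
  "is_chart X (n, U, \<phi>) \<longleftrightarrow> open_embedding_on X (Euclidean_space n) U \<phi>"
  by (simp add: open_embedding_on_def)

declare is_chart.simps [simp del]

lemmas is_chart_openD = open_embedding_on_openD[OF is_chart_iff_open_embedding[THEN iffD1]]
  and is_chart_inj_onD = open_embedding_on_inj_onD[OF is_chart_iff_open_embedding[THEN iffD1]]
  and is_chart_continuousD = open_embedding_on_continuousD[OF is_chart_iff_open_embedding[THEN iffD1]]
  and is_chart_image_open = open_embedding_on_image_open[OF is_chart_iff_open_embedding[THEN iffD1]]
  and is_chart_inv_continuous = open_embedding_on_inv_continuous[OF is_chart_iff_open_embedding[THEN iffD1]]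

lemma is_chart_restrict:
  "is_chart X (n, U, \<phi>) \<Longrightarrow> openin X W \<Longrightarrow> W \<subseteq> U \<Longrightarrow> is_chart X (n, W, \<phi>)"
  by (simp add: is_chart_iff_open_embedding open_embedding_on_subset)

lemma is_chart_image_subset: "is_chart X (n, U, \<phi>) \<Longrightarrow> \<phi> ` U \<subseteq> topspace (Euclidean_space n)"
  by (simp add: is_chart_iff_open_embedding open_embedding_on_image_openD openin_subset)

lemma smooth_on_imp_continuous_map:
  assumes F: "smooth_on m S n F" and "F ` S \<subseteq> T"
  shows "continuous_map (subtopology (Euclidean_space m) S) (subtopology (Euclidean_space n) T) F"
  using smooth_on_imp_continuous_on[OF F] smooth_on_imageD[OF F] assms(2)
    openin_subset[OF smooth_on_openD[OF F]]
  by (simp add: continuous_map_in_subtopology cm_Euclidean_space_iff_continuous_on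
      image_subset_iff Pi_iff inf.absorb2)

lemma smoothly_compatible_sym: "smoothly_compatible c d \<Longrightarrow> smoothly_compatible d c"
  by (cases c; cases d) (simp add: Int_commute)

text \<open>Compatibility is transitive through an atlas, though not through a single chart: near each point
  of the overlap some chart of the atlas is available, and there the transition map factors through it.\<close>

lemma transition_smooth_via_atlas:
  assumes a: "is_chart X (m, U, \<phi>)" and c: "is_chart X (n, V, \<psi>)"
    and A: "smooth_atlas X A"
    and aA: "\<And>b. b \<in> A \<Longrightarrow> smoothly_compatible (m, U, \<phi>) b"
    and Ac: "\<And>b. b \<in> A \<Longrightarrow> smoothly_compatible b (n, V, \<psi>)"
  shows "smooth_on m (\<phi> ` (U \<inter> V)) n (\<psi> \<circ> inv_into U \<phi>)"
proof (rule smooth_on_local)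
  fix y assume "y \<in> \<phi> ` (U \<inter> V)"
  then obtain p where p: "p \<in> U" "p \<in> V" "y = \<phi> p" by auto
  have "p \<in> topspace X"
    using p a openin_subset[OF is_chart_openD[OF a]] by blast
  then have "p \<in> (\<Union>(k, W, \<theta>)\<in>A. W)"
    using A by (simp add: smooth_atlas_def)
  then obtain k W \<theta> where b: "(k, W, \<theta>) \<in> A" "p \<in> W"
    by auto
  have bc: "is_chart X (k, W, \<theta>)"
    using A b by (auto simp: smooth_atlas_def)
  note inj = is_chart_inj_onD[OF a] is_chart_inj_onD[OF bc]
  let ?S = "\<phi> ` (U \<inter> V \<inter> W)"
  have S: "openin (Euclidean_space m) ?S"
    using is_chart_openD[OF a] is_chart_openD[OF c] is_chart_openD[OF bc]
    by (intro is_chart_image_open[OF a]) (auto intro!: openin_Int)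
  have "smooth_on m ?S k (\<theta> \<circ> inv_into U \<phi>)"
    using aA[OF b(1)] by (auto intro: smooth_on_subset[OF _ S])
  moreover have "smooth_on k (\<theta> ` (W \<inter> V)) n (\<psi> \<circ> inv_into W \<theta>)"
    using Ac[OF b(1)] by simp
  moreover have "(\<theta> \<circ> inv_into U \<phi>) ` ?S \<subseteq> \<theta> ` (W \<inter> V)"
    using inj by (auto simp: inv_into_f_f)
  ultimately have "smooth_on m ?S n ((\<psi> \<circ> inv_into W \<theta>) \<circ> (\<theta> \<circ> inv_into U \<phi>))"
    by (rule smooth_on_compose)
  then have "smooth_on m ?S n (\<psi> \<circ> inv_into U \<phi>)"
    by (rule smooth_on_cong) (use inj in \<open>auto simp: inv_into_f_f\<close>)
  then show "\<exists>S'. y \<in> S' \<and> S' \<subseteq> \<phi> ` (U \<inter> V) \<and> smooth_on m S' n (\<psi> \<circ> inv_into U \<phi>)"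
    using p b by (intro exI[of _ ?S]) auto
qed

lemma smoothly_compatible_via_atlas:
  assumes "is_chart X a" "is_chart X c" "smooth_atlas X A"
    and "\<And>b. b \<in> A \<Longrightarrow> smoothly_compatible a b" "\<And>b. b \<in> A \<Longrightarrow> smoothly_compatible c b"
  shows "smoothly_compatible a c"
proof -
  obtain m U \<phi> n V \<psi> where [simp]: "a = (m, U, \<phi>)" "c = (n, V, \<psi>)"
    by (metis prod_cases3)
  note sym = smoothly_compatible_sym[OF assms(4)] smoothly_compatible_sym[OF assms(5)]
  have "smooth_on m (\<phi> ` (U \<inter> V)) n (\<psi> \<circ> inv_into U \<phi>)"
    using assms(1-4) sym(2) by (intro transition_smooth_via_atlas[of X]) simp_all
  moreover have "smooth_on n (\<psi> ` (V \<inter> U)) m (\<phi> \<circ> inv_into V \<psi>)"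
    using assms(1-3,5) sym(1) by (intro transition_smooth_via_atlas[of X]) simp_all
  ultimately show ?thesis
    by (simp add: Int_commute)
qed

text \<open>The differential part of the notion of a manifold.  It is separated from the topological part because
  it is what an atlas generates by itself.\<close>

definition smooth_structure :: "'a topology \<Rightarrow> 'a chart set \<Rightarrow> bool" where
  "smooth_structure X M \<longleftrightarrow> smooth_atlas X M \<and> maximal_atlas X M = M"

lemma atlas_subset_maximal_atlas: "smooth_atlas X A \<Longrightarrow> A \<subseteq> maximal_atlas X A"
  by (auto simp: smooth_atlas_def maximal_atlas_def)

lemma smooth_structure_maximal_atlas:
  assumes A: "smooth_atlas X A"
  shows "smooth_structure X (maximal_atlas X A)"
proof -
  let ?M = "maximal_atlas X A"
  have sub: "A \<subseteq> ?M"
    using A by (rule atlas_subset_maximal_atlas)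
  have chart: "is_chart X c" if "c \<in> ?M" for c
    using that by (simp add: maximal_atlas_def)
  have compat: "smoothly_compatible c d" if "c \<in> ?M" "d \<in> ?M" for c d
    using that A by (intro smoothly_compatible_via_atlas[of X c d A]) (auto simp: maximal_atlas_def)
  have "(\<Union>(n, U, \<phi>)\<in>?M. U) = topspace X"
  proof
    show "(\<Union>(n, U, \<phi>)\<in>?M. U) \<subseteq> topspace X"
    proof
      fix p assume "p \<in> (\<Union>(n, U, \<phi>)\<in>?M. U)"
      then obtain n U \<phi> where "(n, U, \<phi>) \<in> ?M" "p \<in> U"
        by auto
      then show "p \<in> topspace X"
        using openin_subset[OF is_chart_openD[OF chart]] by blast
    qed
    have "topspace X = (\<Union>(n, U, \<phi>)\<in>A. U)"
      using A by (simp add: smooth_atlas_def)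
    also have "\<dots> \<subseteq> (\<Union>(n, U, \<phi>)\<in>?M. U)"
      using sub by (rule UN_mono) simp
    finally show "topspace X \<subseteq> (\<Union>(n, U, \<phi>)\<in>?M. U)" .
  qed
  then have "smooth_atlas X ?M"
    using chart compat by (simp add: smooth_atlas_def)
  moreover have "maximal_atlas X ?M = ?M"
  proof
    show "maximal_atlas X ?M \<subseteq> ?M"
    proof
      fix c assume "c \<in> maximal_atlas X ?M"
      then have "is_chart X c" "\<forall>a\<in>?M. smoothly_compatible c a"
        unfolding maximal_atlas_def[of X ?M] by simp_all
      then show "c \<in> ?M"
        using sub unfolding maximal_atlas_def[of X A] by blast
    qed
    show "?M \<subseteq> maximal_atlas X ?M"
      using chart compat by (intro subsetI) (simp add: maximal_atlas_def[of X ?M])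
  qed
  ultimately show ?thesis
    by (simp add: smooth_structure_def)
qed

context
  fixes X :: "'a topology" and M :: "'a chart set"
  assumes M: "smooth_structure X M"
begin

lemma structure_chart: "c \<in> M \<Longrightarrow> is_chart X c"
  using M by (auto simp: smooth_structure_def smooth_atlas_def)

lemma structure_compatible: "c \<in> M \<Longrightarrow> d \<in> M \<Longrightarrow> smoothly_compatible c d"
  using M by (auto simp: smooth_structure_def smooth_atlas_def)

lemma structure_covers:
  assumes "p \<in> topspace X"
  obtains n U \<phi> where "(n, U, \<phi>) \<in> M" "p \<in> U"
proof -
  have "p \<in> (\<Union>(n, U, \<phi>)\<in>M. U)"
    using M assms by (simp add: smooth_structure_def smooth_atlas_def)
  then show ?thesis
    using that by auto
qed

lemma structure_maximal:
  "is_chart X c \<Longrightarrow> (\<And>a. a \<in> M \<Longrightarrow> smoothly_compatible c a) \<Longrightarrow> c \<in> M"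
  using M by (auto simp: smooth_structure_def maximal_atlas_def)

text \<open>Maximality is used to shrink chart domains, so that a chart fits into a given open set.\<close>

lemma structure_restrict:
  assumes c: "(n, U, \<phi>) \<in> M" and W: "openin X W" "W \<subseteq> U"
  shows "(n, W, \<phi>) \<in> M"
proof (rule structure_maximal)
  show cW: "is_chart X (n, W, \<phi>)"
    using is_chart_restrict[OF structure_chart[OF c] W] .
  fix a assume a: "a \<in> M"
  obtain m V \<psi> where [simp]: "a = (m, V, \<psi>)"
    by (metis prod_cases3)
  have V: "is_chart X (m, V, \<psi>)"
    using structure_chart[OF a] by simp
  have WV: "openin X (W \<inter> V)" "openin X (V \<inter> W)"
    using W is_chart_openD[OF V] by (auto intro: openin_Int)
  have inj: "inj_on \<phi> U"
    using is_chart_inj_onD[OF structure_chart[OF c]] .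
  have 1: "smooth_on n (\<phi> ` (U \<inter> V)) m (\<psi> \<circ> inv_into U \<phi>)"
    and 2: "smooth_on m (\<psi> ` (U \<inter> V)) n (\<phi> \<circ> inv_into V \<psi>)"
    using structure_compatible[OF c a] by simp_all
  have "smooth_on n (\<phi> ` (W \<inter> V)) m (\<psi> \<circ> inv_into U \<phi>)"
    using W is_chart_image_open[OF cW WV(1)] by (intro smooth_on_subset[OF 1]) auto
  then have "smooth_on n (\<phi> ` (W \<inter> V)) m (\<psi> \<circ> inv_into W \<phi>)"
    by (rule smooth_on_cong) (use inj W in \<open>auto simp: inv_into_subset_eq[OF inj W(2)]\<close>)
  moreover have "smooth_on m (\<psi> ` (W \<inter> V)) n (\<phi> \<circ> inv_into V \<psi>)"
    using W is_chart_image_open[OF V WV(1)] by (intro smooth_on_subset[OF 2]) auto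
  ultimately show "smoothly_compatible (n, W, \<phi>) a"
    by simp
qed

end


section \<open>Smooth maps\<close>

lemma smooth_mapI:
  assumes "\<And>p. p \<in> S \<Longrightarrow> \<exists>m U \<phi> n V \<psi>. (m, U, \<phi>) \<in> M \<and> (n, V, \<psi>) \<in> N \<and>
     p \<in> U \<and> U \<subseteq> S \<and> f ` U \<subseteq> V \<and> smooth_on m (\<phi> ` U) n (\<psi> \<circ> f \<circ> inv_into U \<phi>)"
  shows "smooth_map M N S f"
  unfolding smooth_map_def
proof
  fix p assume "p \<in> S"
  from assms[OF this] obtain m U \<phi> n V \<psi> where "(m, U, \<phi>) \<in> M" "(n, V, \<psi>) \<in> N" "p \<in> U" "U \<subseteq> S"
    "f ` U \<subseteq> V" "smooth_on m (\<phi> ` U) n (\<psi> \<circ> f \<circ> inv_into U \<phi>)"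
    by blast
  then show "\<exists>(m, U, \<phi>)\<in>M. \<exists>(n, V, \<psi>)\<in>N. p \<in> U \<and> U \<subseteq> S \<and> f ` U \<subseteq> V \<and>
      smooth_on m (\<phi> ` U) n (\<psi> \<circ> f \<circ> inv_into U \<phi>)"
    by (auto intro!: bexI[of _ "(m, U, \<phi>)"] bexI[of _ "(n, V, \<psi>)"])
qed

lemma smooth_mapE:
  assumes "smooth_map M N S f" "p \<in> S"
  obtains m U \<phi> n V \<psi> where "(m, U, \<phi>) \<in> M" "(n, V, \<psi>) \<in> N" "p \<in> U" "U \<subseteq> S" "f ` U \<subseteq> V"
    "smooth_on m (\<phi> ` U) n (\<psi> \<circ> f \<circ> inv_into U \<phi>)"
  using assms unfolding smooth_map_def by fast

lemma smooth_map_locally: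
  assumes "\<And>p. p \<in> S \<Longrightarrow> \<exists>S'. p \<in> S' \<and> S' \<subseteq> S \<and> smooth_map M N S' f"
  shows "smooth_map M N S f"
proof (rule smooth_mapI)
  fix p assume "p \<in> S"
  then obtain S' where S': "p \<in> S'" "S' \<subseteq> S" "smooth_map M N S' f"
    using assms by blast
  obtain m U \<phi> n V \<psi> where "(m, U, \<phi>) \<in> M" "(n, V, \<psi>) \<in> N" "p \<in> U" "U \<subseteq> S'" "f ` U \<subseteq> V"
    "smooth_on m (\<phi> ` U) n (\<psi> \<circ> f \<circ> inv_into U \<phi>)"
    using S'(3,1) by (rule smooth_mapE)
  with S'(2) show "\<exists>m U \<phi> n V \<psi>. (m, U, \<phi>) \<in> M \<and> (n, V, \<psi>) \<in> N \<and>
     p \<in> U \<and> U \<subseteq> S \<and> f ` U \<subseteq> V \<and> smooth_on m (\<phi> ` U) n (\<psi> \<circ> f \<circ> inv_into U \<phi>)"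
    by blast
qed

lemma smooth_map_cong:
  assumes "smooth_map M N S f" "\<And>x. x \<in> S \<Longrightarrow> f x = g x"
  shows "smooth_map M N S g"
proof (rule smooth_mapI)
  fix p assume "p \<in> S"
  then obtain m U \<phi> n V \<psi> where *: "(m, U, \<phi>) \<in> M" "(n, V, \<psi>) \<in> N" "p \<in> U" "U \<subseteq> S" "f ` U \<subseteq> V"
    "smooth_on m (\<phi> ` U) n (\<psi> \<circ> f \<circ> inv_into U \<phi>)"
    using smooth_mapE[OF assms(1)] by metis
  have "smooth_on m (\<phi> ` U) n (\<psi> \<circ> g \<circ> inv_into U \<phi>)"
    using *(6)
  proof (rule smooth_on_cong)
    fix y assume "y \<in> \<phi> ` U"
    then have "inv_into U \<phi> y \<in> S"
      by (intro subsetD[OF *(4)] inv_into_into)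
    then show "(\<psi> \<circ> f \<circ> inv_into U \<phi>) y = (\<psi> \<circ> g \<circ> inv_into U \<phi>) y"
      by (simp add: assms(2))
  qed
  moreover have "g ` U \<subseteq> V"
    using *(4,5) assms(2) by force
  ultimately show "\<exists>m U \<phi> n V \<psi>. (m, U, \<phi>) \<in> M \<and> (n, V, \<psi>) \<in> N \<and>
     p \<in> U \<and> U \<subseteq> S \<and> g ` U \<subseteq> V \<and> smooth_on m (\<phi> ` U) n (\<psi> \<circ> g \<circ> inv_into U \<phi>)"
    using * by blast
qed

text \<open>The definition only provides some pair of charts at each point.  Changing coordinates on both
  sides shows that a smooth map is smooth in any charts.\<close>

lemma smooth_map_in_charts:
  assumes M: "smooth_structure X M" and N: "smooth_structure Y N" and f: "smooth_map M N S f"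
    and c: "(m, U, \<phi>) \<in> M" and d: "(n, V, \<psi>) \<in> N" and US: "U \<subseteq> S" and fU: "f ` U \<subseteq> V"
  shows "smooth_on m (\<phi> ` U) n (\<psi> \<circ> f \<circ> inv_into U \<phi>)"
proof (rule smooth_on_local)
  fix y assume "y \<in> \<phi> ` U"
  then obtain p where p: "p \<in> U" "y = \<phi> p" by auto
  then have "p \<in> S" using US by blast
  with f obtain m' U' \<phi>' n' V' \<psi>' where *: "(m', U', \<phi>') \<in> M" "(n', V', \<psi>') \<in> N" "p \<in> U'" "U' \<subseteq> S"
    "f ` U' \<subseteq> V'" "smooth_on m' (\<phi>' ` U') n' (\<psi>' \<circ> f \<circ> inv_into U' \<phi>')"
    by (rule smooth_mapE)
  note inj = is_chart_inj_onD[OF structure_chart[OF M c]] is_chart_inj_onD[OF structure_chart[OF M *(1)]]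
    is_chart_inj_onD[OF structure_chart[OF N *(2)]]
  let ?S = "\<phi> ` (U \<inter> U')"
  have 1: "smooth_on m ?S m' (\<phi>' \<circ> inv_into U \<phi>)"
    using structure_compatible[OF M c *(1)] by simp
  have 2: "smooth_on n' (\<psi>' ` (V' \<inter> V)) n (\<psi> \<circ> inv_into V' \<psi>')"
    using structure_compatible[OF N *(2) d] by simp
  have "smooth_on m ?S n' ((\<psi>' \<circ> f \<circ> inv_into U' \<phi>') \<circ> (\<phi>' \<circ> inv_into U \<phi>))"
    using inj by (intro smooth_on_compose[OF 1 *(6)]) (auto simp: inv_into_f_f)
  then have "smooth_on m ?S n ((\<psi> \<circ> inv_into V' \<psi>') \<circ> ((\<psi>' \<circ> f \<circ> inv_into U' \<phi>') \<circ> (\<phi>' \<circ> inv_into U \<phi>)))"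
    using 2 by (rule smooth_on_compose) (use inj fU *(5) in \<open>auto simp: inv_into_f_f image_subset_iff\<close>)
  then have "smooth_on m ?S n (\<psi> \<circ> f \<circ> inv_into U \<phi>)"
    by (rule smooth_on_cong) (use inj *(5) in \<open>auto simp: inv_into_f_f image_subset_iff\<close>)
  then show "\<exists>S'. y \<in> S' \<and> S' \<subseteq> \<phi> ` U \<and> smooth_on m S' n (\<psi> \<circ> f \<circ> inv_into U \<phi>)"
    using p *(3) by (intro exI[of _ ?S]) auto
qed

text \<open>In charts, a smooth map is continuous because its coordinate expressions are.  The conclusion is
  stated for preimages within S, and thus also says that S is open.\<close>

lemma smooth_map_preimage_open:
  assumes M: "smooth_structure X M" and N: "smooth_structure Y N" and f: "smooth_map M N S f"
    and W: "openin Y W"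
  shows "openin X {x \<in> S. f x \<in> W}"
proof (subst openin_subopen, intro ballI)
  fix p assume p: "p \<in> {x \<in> S. f x \<in> W}"
  then have "p \<in> S" by simp
  with f obtain m U \<phi> n V \<psi> where *: "(m, U, \<phi>) \<in> M" "(n, V, \<psi>) \<in> N" "p \<in> U" "U \<subseteq> S" "f ` U \<subseteq> V"
    "smooth_on m (\<phi> ` U) n (\<psi> \<circ> f \<circ> inv_into U \<phi>)"
    by (rule smooth_mapE)
  note c = structure_chart[OF M *(1)] and d = structure_chart[OF N *(2)]
  note inj = is_chart_inj_onD[OF c] is_chart_inj_onD[OF d]
  have U: "openin X U" and top: "topspace (subtopology X U) = U"
    using is_chart_openD[OF c] openin_subset by fastforce+
  have "continuous_map (subtopology (Euclidean_space m) (\<phi> ` U)) (subtopology (Euclidean_space n) (\<psi> ` V))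
      (\<psi> \<circ> f \<circ> inv_into U \<phi>)"
    using *(5) inj by (intro smooth_on_imp_continuous_map[OF *(6)]) (auto simp: inv_into_f_f)
  then have "continuous_map (subtopology X U) Y (inv_into V \<psi> \<circ> ((\<psi> \<circ> f \<circ> inv_into U \<phi>) \<circ> \<phi>))"
    using is_chart_continuousD[OF c] is_chart_inv_continuous[OF d]
    by (blast intro: continuous_map_compose)
  then have "continuous_map (subtopology X U) Y f"
    by (rule continuous_map_eq) (use inj *(5) top in \<open>auto simp: inv_into_f_f image_subset_iff\<close>)
  from openin_continuous_map_preimage[OF this W]
  have "openin X {x \<in> U. f x \<in> W}"
    unfolding top using U by (simp add: openin_open_subtopology)
  then show "\<exists>T. openin X T \<and> p \<in> T \<and> T \<subseteq> {x \<in> S. f x \<in> W}"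
    using p *(3,4) by (intro exI[of _ "{x \<in> U. f x \<in> W}"]) auto
qed

lemma smooth_map_subset:
  assumes M: "smooth_structure X M" and f: "smooth_map M N S f" and S': "openin X S'" "S' \<subseteq> S"
  shows "smooth_map M N S' f"
proof (rule smooth_mapI)
  fix p assume p: "p \<in> S'"
  then have "p \<in> S" using S' by blast
  with f obtain m U \<phi> n V \<psi> where *: "(m, U, \<phi>) \<in> M" "(n, V, \<psi>) \<in> N" "p \<in> U" "U \<subseteq> S" "f ` U \<subseteq> V"
    "smooth_on m (\<phi> ` U) n (\<psi> \<circ> f \<circ> inv_into U \<phi>)"
    by (rule smooth_mapE)
  note c = structure_chart[OF M *(1)]
  have W: "openin X (U \<inter> S')"
    using is_chart_openD[OF c] S'(1) by (rule openin_Int)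
  have "smooth_on m (\<phi> ` (U \<inter> S')) n (\<psi> \<circ> f \<circ> inv_into U \<phi>)"
    using is_chart_image_open[OF c W] by (intro smooth_on_subset[OF *(6)]) auto
  then have "smooth_on m (\<phi> ` (U \<inter> S')) n (\<psi> \<circ> f \<circ> inv_into (U \<inter> S') \<phi>)"
    by (rule smooth_on_cong) (simp add: inv_into_subset_eq[OF is_chart_inj_onD[OF c]])
  moreover have "(m, U \<inter> S', \<phi>) \<in> M"
    using structure_restrict[OF M *(1) W] by simp
  ultimately show "\<exists>m U \<phi> n V \<psi>. (m, U, \<phi>) \<in> M \<and> (n, V, \<psi>) \<in> N \<and>
     p \<in> U \<and> U \<subseteq> S' \<and> f ` U \<subseteq> V \<and> smooth_on m (\<phi> ` U) n (\<psi> \<circ> f \<circ> inv_into U \<phi>)"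
    using *(2,3,5) p by blast
qed

lemma smooth_map_compose:
  assumes M: "smooth_structure X M" and N: "smooth_structure Y N"
    and f: "smooth_map M N S f" and g: "smooth_map N P T g" and fS: "f ` S \<subseteq> T"
  shows "smooth_map M P S (g \<circ> f)"
proof (rule smooth_mapI)
  fix p assume p: "p \<in> S"
  then have "f p \<in> T" using fS by blast
  with g obtain n V \<psi> k W \<theta> where g': "(n, V, \<psi>) \<in> N" "(k, W, \<theta>) \<in> P" "f p \<in> V" "V \<subseteq> T" "g ` V \<subseteq> W"
    "smooth_on n (\<psi> ` V) k (\<theta> \<circ> g \<circ> inv_into V \<psi>)"
    by (rule smooth_mapE)
  obtain m U \<phi> where U: "(m, U, \<phi>) \<in> M" "p \<in> U"
    using smooth_mapE[OF f p] by metis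
  note c = structure_chart[OF M U(1)] and d = structure_chart[OF N g'(1)]
  let ?U = "U \<inter> {x \<in> S. f x \<in> V}"
  have "openin X ?U"
    using is_chart_openD[OF c] smooth_map_preimage_open[OF M N f is_chart_openD[OF d]] by (rule openin_Int)
  then have U': "(m, ?U, \<phi>) \<in> M"
    by (rule structure_restrict[OF M U(1)]) simp
  have inj: "inj_on \<phi> ?U" "inj_on \<psi> V"
    using is_chart_inj_onD[OF structure_chart[OF M U']] is_chart_inj_onD[OF d] by auto
  have "smooth_on m (\<phi> ` ?U) n (\<psi> \<circ> f \<circ> inv_into ?U \<phi>)"
    by (rule smooth_map_in_charts[OF M N f U' g'(1)]) auto
  then have "smooth_on m (\<phi> ` ?U) k ((\<theta> \<circ> g \<circ> inv_into V \<psi>) \<circ> (\<psi> \<circ> f \<circ> inv_into ?U \<phi>))"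
    using g'(6) by (rule smooth_on_compose) (use inj(1) in \<open>auto simp: inv_into_f_f\<close>)
  then have "smooth_on m (\<phi> ` ?U) k (\<theta> \<circ> (g \<circ> f) \<circ> inv_into ?U \<phi>)"
    by (rule smooth_on_cong) (use inj in \<open>auto simp: inv_into_f_f\<close>)
  moreover have "(g \<circ> f) ` ?U \<subseteq> W"
    using g'(5) by auto
  ultimately show "\<exists>m U \<phi> n V \<psi>. (m, U, \<phi>) \<in> M \<and> (n, V, \<psi>) \<in> P \<and>
     p \<in> U \<and> U \<subseteq> S \<and> (g \<circ> f) ` U \<subseteq> V \<and> smooth_on m (\<phi> ` U) n (\<psi> \<circ> (g \<circ> f) \<circ> inv_into U \<phi>)"
    using U' g'(2,3) p U(2)
    by (intro exI[of _ m] exI[of _ ?U] exI[of _ \<phi>] exI[of _ k] exI[of _ W] exI[of _ \<theta>]) auto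
qed

text \<open>Read in charts, the identity is the transition map.  Exchanging the two structures gives equality.\<close>

lemma smooth_structure_subset:
  assumes M: "smooth_structure X M" and N: "smooth_structure X N"
    and MN: "smooth_map M N (topspace X) (\<lambda>x. x)" and NM: "smooth_map N M (topspace X) (\<lambda>x. x)"
  shows "M \<subseteq> N"
proof
  fix c assume cM: "c \<in> M"
  obtain m U \<phi> where [simp]: "c = (m, U, \<phi>)"
    by (metis prod_cases3)
  have c: "is_chart X (m, U, \<phi>)"
    using structure_chart[OF M cM] by simp
  show "c \<in> N"
  proof (rule structure_maximal[OF N structure_chart[OF M cM]])
    fix d assume dN: "d \<in> N"
    obtain n V \<psi> where [simp]: "d = (n, V, \<psi>)"
      by (metis prod_cases3)
    have d: "is_chart X (n, V, \<psi>)"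
      using structure_chart[OF N dN] by simp
    have W: "openin X (U \<inter> V)"
      using is_chart_openD[OF c] is_chart_openD[OF d] by (rule openin_Int)
    have 1: "(m, U \<inter> V, \<phi>) \<in> M"
      using cM by (intro structure_restrict[OF M _ W]) auto
    have 2: "(n, U \<inter> V, \<psi>) \<in> N"
      using dN by (intro structure_restrict[OF N _ W]) auto
    have "smooth_on m (\<phi> ` (U \<inter> V)) n (\<psi> \<circ> (\<lambda>x. x) \<circ> inv_into (U \<inter> V) \<phi>)"
      using openin_subset[OF W] by (intro smooth_map_in_charts[OF M N MN 1 2]) auto
    then have "smooth_on m (\<phi> ` (U \<inter> V)) n (\<psi> \<circ> inv_into U \<phi>)"
      by (rule smooth_on_cong) (simp add: inv_into_subset_eq[OF is_chart_inj_onD[OF c]])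
    moreover have "smooth_on n (\<psi> ` (U \<inter> V)) m (\<phi> \<circ> (\<lambda>x. x) \<circ> inv_into (U \<inter> V) \<psi>)"
      using openin_subset[OF W] by (intro smooth_map_in_charts[OF N M NM 2 1]) auto
    then have "smooth_on n (\<psi> ` (U \<inter> V)) m (\<phi> \<circ> inv_into V \<psi>)"
      by (rule smooth_on_cong) (simp add: inv_into_subset_eq[OF is_chart_inj_onD[OF d]])
    ultimately show "smoothly_compatible c d"
      by simp
  qed
qed

text \<open>The chain rule in charts.  Applied to a local left inverse it makes a map immersive, applied to a
  local section it makes a map submersive.\<close>

lemma differential_left_inverse:
  assumes M: "smooth_structure X M" and N: "smooth_structure Y N"
    and f: "smooth_map M N S f" and g: "smooth_map N M T g"
    and gf: "\<And>q. q \<in> S \<Longrightarrow> f q \<in> T \<Longrightarrow> g (f q) = q"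
    and c: "(m, U, \<phi>) \<in> M" and d: "(n, V, \<psi>) \<in> N"
    and p: "p \<in> S" "p \<in> U" "f p \<in> T" "f p \<in> V"
    and v: "v \<in> topspace (Euclidean_space m)"
  shows "differential n m (\<phi> \<circ> g \<circ> inv_into V \<psi>) (\<psi> (f p))
           (differential m n (\<psi> \<circ> f \<circ> inv_into U \<phi>) (\<phi> p) v) = v"
proof -
  note cc = structure_chart[OF M c] and dd = structure_chart[OF N d]
  note inj = is_chart_inj_onD[OF cc] is_chart_inj_onD[OF dd]
  define V' where "V' = V \<inter> {y \<in> T. g y \<in> U}"
  define U' where "U' = U \<inter> {x \<in> S. f x \<in> V'}"
  have V': "openin Y V'"
    unfolding V'_def using is_chart_openD[OF dd] smooth_map_preimage_open[OF N M g is_chart_openD[OF cc]]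
    by (rule openin_Int)
  have U': "openin X U'"
    unfolding U'_def using is_chart_openD[OF cc] smooth_map_preimage_open[OF M N f V']
    by (rule openin_Int)
  have c': "(m, U', \<phi>) \<in> M" and d': "(n, V', \<psi>) \<in> N"
    using structure_restrict[OF M c U'] structure_restrict[OF N d V'] by (auto simp: U'_def V'_def)
  have sub: "U' \<subseteq> U" "V' \<subseteq> V"
    by (auto simp: U'_def V'_def)
  have "smooth_on m (\<phi> ` U') n (\<psi> \<circ> f \<circ> inv_into U' \<phi>)"
    by (rule smooth_map_in_charts[OF M N f c' d']) (auto simp: U'_def)
  then have F: "smooth_on m (\<phi> ` U') n (\<psi> \<circ> f \<circ> inv_into U \<phi>)"
    by (rule smooth_on_cong) (simp add: inv_into_subset_eq[OF inj(1) sub(1)])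
  have "smooth_on n (\<psi> ` V') m (\<phi> \<circ> g \<circ> inv_into V' \<psi>)"
    by (rule smooth_map_in_charts[OF N M g d' c]) (auto simp: V'_def)
  then have H: "smooth_on n (\<psi> ` V') m (\<phi> \<circ> g \<circ> inv_into V \<psi>)"
    by (rule smooth_on_cong) (simp add: inv_into_subset_eq[OF inj(2) sub(2)])
  have pU': "p \<in> U'"
    using p gf by (auto simp: U'_def V'_def)
  have FU: "(\<psi> \<circ> f \<circ> inv_into U \<phi>) ` (\<phi> ` U') \<subseteq> \<psi> ` V'"
    using inj by (auto simp: U'_def inv_into_f_f)
  have "differential n m (\<phi> \<circ> g \<circ> inv_into V \<psi>) ((\<psi> \<circ> f \<circ> inv_into U \<phi>) (\<phi> p))
          (differential m n (\<psi> \<circ> f \<circ> inv_into U \<phi>) (\<phi> p) v)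
      = differential m m ((\<phi> \<circ> g \<circ> inv_into V \<psi>) \<circ> (\<psi> \<circ> f \<circ> inv_into U \<phi>)) (\<phi> p) v"
    using pU' by (intro differential_compose[OF F H FU, symmetric]) auto
  also have "\<dots> = v"
    using is_chart_image_open[OF cc U' sub(1)] pU' v
    by (intro differential_identity_near[of m "\<phi> ` U'"])
      (use inj gf in \<open>auto simp: inv_into_f_f U'_def V'_def\<close>)
  finally show ?thesis
    using p inj by (simp add: inv_into_f_f)
qed

lemma diffeomorphismI:
  assumes "smooth_map M N S f" "smooth_map N M T g" "f ` S \<subseteq> T" "g ` T \<subseteq> S"
    and gf: "\<And>x. x \<in> S \<Longrightarrow> g (f x) = x" and fg: "\<And>y. y \<in> T \<Longrightarrow> f (g y) = y"
  shows "diffeomorphism M N S T f"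
proof -
  have bij: "bij_betw f S T"
    using assms(3,4) gf fg by (intro bij_betw_byWitness[of _ g]) auto
  have "g y = inv_into S f y" if "y \<in> T" for y
    using that assms(4) fg gf bij by (metis bij_betw_imp_inj_on image_subset_iff inv_into_f_f)
  with assms(2) have "smooth_map N M T (inv_into S f)"
    by (rule smooth_map_cong)
  then show ?thesis
    using bij assms(1) by (simp add: diffeomorphism_def)
qed

lemma local_diffeomorphism_imp_submersion:
  assumes M: "smooth_structure X M" and N: "smooth_structure Y N"
    and f: "local_diffeomorphism X M Y N f"
  shows "submersion X M N f"
proof -
  have loc: "\<exists>U. p \<in> U \<and> openin X U \<and> bij_betw f U (f ` U) \<and> smooth_map M N U f \<and>
      smooth_map N M (f ` U) (inv_into U f)" if "p \<in> topspace X" for p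
    using f that unfolding local_diffeomorphism_def diffeomorphism_def by blast
  have smooth: "smooth_map M N (topspace X) f"
  proof (rule smooth_map_locally)
    fix p assume "p \<in> topspace X"
    from loc[OF this] show "\<exists>S'. p \<in> S' \<and> S' \<subseteq> topspace X \<and> smooth_map M N S' f"
      using openin_subset by blast
  qed
  moreover have "differential m n (\<psi> \<circ> f \<circ> inv_into U \<phi>) (\<phi> p) ` topspace (Euclidean_space m)
      = topspace (Euclidean_space n)"
    if c: "(m, U, \<phi>) \<in> M" and d: "(n, V, \<psi>) \<in> N" and p: "p \<in> U" "f p \<in> V" for m U \<phi> n V \<psi> p
  proof
    show "differential m n (\<psi> \<circ> f \<circ> inv_into U \<phi>) (\<phi> p) ` topspace (Euclidean_space m)
        \<subseteq> topspace (Euclidean_space n)"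
      using differential_in_Euclidean by blast
    have "p \<in> topspace X"
      using p openin_subset[OF is_chart_openD[OF structure_chart[OF M c]]] by blast
    from loc[OF this] obtain W where W: "p \<in> W" "inj_on f W" "smooth_map M N W f"
      "smooth_map N M (f ` W) (inv_into W f)"
      by (auto simp: bij_betw_def)
    have gp: "inv_into W f (f p) = p"
      using W by (simp add: inv_into_f_f)
    show "topspace (Euclidean_space n) \<subseteq>
        differential m n (\<psi> \<circ> f \<circ> inv_into U \<phi>) (\<phi> p) ` topspace (Euclidean_space m)"
    proof
      fix w assume w: "w \<in> topspace (Euclidean_space n)"
      have "w = differential m n (\<psi> \<circ> f \<circ> inv_into U \<phi>) (\<phi> p)
          (differential n m (\<phi> \<circ> inv_into W f \<circ> inv_into V \<psi>) (\<psi> (f p)) w)"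
        using differential_left_inverse[OF N M W(4,3) _ d c _ _ _ _ w, of "f p"] W p
        by (simp add: gp f_inv_into_f)
      then show "w \<in> differential m n (\<psi> \<circ> f \<circ> inv_into U \<phi>) (\<phi> p) ` topspace (Euclidean_space m)"
        using differential_in_Euclidean by blast
    qed
  qed
  ultimately show ?thesis
    unfolding submersion_def by blast
qed


section \<open>Product manifolds\<close>

text \<open>Smoothness of multiplication refers to the product structure on pairs of arrows.  What is needed is
  that product charts form an atlas and that the first projection is smooth; both follow from the smooth
  maps that extract the two blocks of coordinates.\<close>

definition fst_coords :: "nat \<Rightarrow> (nat \<Rightarrow> real) \<Rightarrow> nat \<Rightarrow> real" where
  "fst_coords m y = (\<lambda>i. if i < m then y i else 0)"

text \<open>For points of the Cartesian space of dimension m + n, whose coordinates vanish from m + n on, the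
  shifted point lies in the Cartesian space of dimension n.\<close>

definition snd_coords :: "nat \<Rightarrow> (nat \<Rightarrow> real) \<Rightarrow> nat \<Rightarrow> real" where
  "snd_coords m y = (\<lambda>i. y (m + i))"

definition prod_coords ::
    "nat \<Rightarrow> ('a \<Rightarrow> nat \<Rightarrow> real) \<Rightarrow> ('b \<Rightarrow> nat \<Rightarrow> real) \<Rightarrow> 'a \<times> 'b \<Rightarrow> nat \<Rightarrow> real" where
  "prod_coords m \<phi> \<psi> = (\<lambda>(p, q) i. if i < m then \<phi> p i else \<psi> q (i - m))"

lemma smooth_on_fst_coords:
  assumes "openin (Euclidean_space (m + n)) S"
  shows "smooth_on (m + n) S m (fst_coords m)"
  using assms by (auto simp: smooth_on_def fst_coords_def topspace_Euclidean_space Ck_on_coordinate)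

lemma smooth_on_snd_coords:
  assumes "openin (Euclidean_space (m + n)) S"
  shows "smooth_on (m + n) S n (snd_coords m)"
  using assms openin_subset[OF assms]
  by (auto simp: smooth_on_def snd_coords_def topspace_Euclidean_space Ck_on_coordinate)

lemma smooth_on_pair:
  assumes F: "smooth_on k S m F" and G: "smooth_on k S n G"
  shows "smooth_on k S (m + n) (\<lambda>x i. if i < m then F x i else G x (i - m))"
  unfolding smooth_on_def
proof (intro conjI allI impI)
  show "openin (Euclidean_space k) S"
    using F by (rule smooth_on_openD)
  show "(\<lambda>x i. if i < m then F x i else G x (i - m)) ` S \<subseteq> topspace (Euclidean_space (m + n))"
    using smooth_on_imageD[OF G] by (auto simp: topspace_Euclidean_space image_subset_iff)
  show "Ck_on l k S (\<lambda>x. if i < m then F x i else G x (i - m))" if "i < m + n" for i l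
    using smooth_on_CkD[OF F, of i l] smooth_on_CkD[OF G, of "i - m" l] that
    by (cases "i < m") auto
qed

lemma prod_coords_image:
  assumes "\<phi> ` U \<subseteq> topspace (Euclidean_space m)" "\<psi> ` V \<subseteq> topspace (Euclidean_space n)"
  shows "prod_coords m \<phi> \<psi> ` (U \<times> V) =
    {y \<in> topspace (Euclidean_space (m + n)). fst_coords m y \<in> \<phi> ` U \<and> snd_coords m y \<in> \<psi> ` V}"
    (is "_ = ?R")
    and fst_prod_coords: "p \<in> U \<Longrightarrow> fst_coords m (prod_coords m \<phi> \<psi> (p, q)) = \<phi> p"
    and snd_prod_coords: "snd_coords m (prod_coords m \<phi> \<psi> (p, q)) = \<psi> q"
proof -
  show fst: "fst_coords m (prod_coords m \<phi> \<psi> (p, q)) = \<phi> p" if "p \<in> U" for p q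
    using assms(1) that by (auto simp: fst_coords_def prod_coords_def topspace_Euclidean_space fun_eq_iff)
  show snd: "snd_coords m (prod_coords m \<phi> \<psi> (p, q)) = \<psi> q" for p q
    by (auto simp: snd_coords_def prod_coords_def fun_eq_iff)
  show "prod_coords m \<phi> \<psi> ` (U \<times> V) = ?R"
  proof
    show "prod_coords m \<phi> \<psi> ` (U \<times> V) \<subseteq> ?R"
    proof clarify
      fix p q assume "p \<in> U" "q \<in> V"
      moreover have "prod_coords m \<phi> \<psi> (p, q) \<in> topspace (Euclidean_space (m + n))"
        using assms(2) \<open>q \<in> V\<close> by (auto simp: prod_coords_def topspace_Euclidean_space)
      ultimately show "prod_coords m \<phi> \<psi> (p, q) \<in> topspace (Euclidean_space (m + n)) \<and>
          fst_coords m (prod_coords m \<phi> \<psi> (p, q)) \<in> \<phi> ` U \<and> snd_coords m (prod_coords m \<phi> \<psi> (p, q)) \<in> \<psi> ` V"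
        by (simp add: fst snd)
    qed
    show "?R \<subseteq> prod_coords m \<phi> \<psi> ` (U \<times> V)"
    proof
      fix y assume "y \<in> ?R"
      then obtain p q where pq: "p \<in> U" "q \<in> V" "fst_coords m y = \<phi> p" "snd_coords m y = \<psi> q"
        by auto
      have "y i = prod_coords m \<phi> \<psi> (p, q) i" for i
        using fun_cong[OF pq(3), of i] fun_cong[OF pq(4), of "i - m"]
        by (auto simp: prod_coords_def fst_coords_def snd_coords_def)
      then have "y = prod_coords m \<phi> \<psi> (p, q)"
        by (rule ext)
      then show "y \<in> prod_coords m \<phi> \<psi> ` (U \<times> V)"
        using pq by blast
    qed
  qed
qed

lemma open_coords_product:
  assumes P: "openin (Euclidean_space m) P" and Q: "openin (Euclidean_space n) Q"
  shows "openin (Euclidean_space (m + n))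
    {y \<in> topspace (Euclidean_space (m + n)). fst_coords m y \<in> P \<and> snd_coords m y \<in> Q}"
proof -
  let ?E = "Euclidean_space (m + n)"
  have top: "openin ?E (topspace ?E)" by simp
  have "continuous_map (subtopology ?E (topspace ?E))
      (subtopology (Euclidean_space m) (topspace (Euclidean_space m))) (fst_coords m)"
    using smooth_on_fst_coords[OF top] by (rule smooth_on_imp_continuous_map)
      (use smooth_on_imageD[OF smooth_on_fst_coords[OF top]] in auto)
  from openin_continuous_map_preimage[OF this, of P] P
  have 1: "openin ?E {y \<in> topspace ?E. fst_coords m y \<in> P}" by simp
  have "continuous_map (subtopology ?E (topspace ?E))
      (subtopology (Euclidean_space n) (topspace (Euclidean_space n))) (snd_coords m)"
    using smooth_on_snd_coords[OF top] by (rule smooth_on_imp_continuous_map)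
      (use smooth_on_imageD[OF smooth_on_snd_coords[OF top]] in auto)
  from openin_continuous_map_preimage[OF this, of Q] Q
  have 2: "openin ?E {y \<in> topspace ?E. snd_coords m y \<in> Q}" by simp
  have "{y \<in> topspace ?E. fst_coords m y \<in> P \<and> snd_coords m y \<in> Q} =
      {y \<in> topspace ?E. fst_coords m y \<in> P} \<inter> {y \<in> topspace ?E. snd_coords m y \<in> Q}"
    by blast
  then show ?thesis
    using openin_Int[OF 1 2] by simp
qed

lemma is_chart_coordinate_continuous:
  assumes "is_chart X (n, U, \<phi>)"
  shows "continuous_map (subtopology X U) euclideanreal (\<lambda>x. \<phi> x i)"
proof -
  have "continuous_map (subtopology X U) (powertop_real UNIV) \<phi>"
    using is_chart_continuousD[OF assms] by (simp add: Euclidean_space_def continuous_map_in_subtopology)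
  from continuous_map_compose[OF this continuous_map_product_projection[of i]]
  show ?thesis by (simp add: o_def)
qed

lemma is_chart_prod:
  assumes c: "is_chart X (m, U, \<phi>)" and d: "is_chart Y (n, V, \<psi>)"
  shows "is_chart (prod_topology X Y) (m + n, U \<times> V, prod_coords m \<phi> \<psi>)"
proof -
  note sub = is_chart_image_subset[OF c] is_chart_image_subset[OF d]
  note image = prod_coords_image[OF sub]
  note inj = is_chart_inj_onD[OF c] is_chart_inj_onD[OF d]
  let ?E = "Euclidean_space (m + n)" and ?c = "prod_coords m \<phi> \<psi>"
  let ?T = "prod_topology (subtopology X U) (subtopology Y V)"
  define g where "g y = (inv_into U \<phi> (fst_coords m y), inv_into V \<psi> (snd_coords m y))" for y
  have topT: "topspace ?T = U \<times> V"
    using openin_subset[OF is_chart_openD[OF c]] openin_subset[OF is_chart_openD[OF d]] by auto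
  have op: "openin ?E (?c ` (U \<times> V))"
    unfolding image using c d
    by (intro open_coords_product) (simp_all add: is_chart_iff_open_embedding open_embedding_on_image_openD)
  have topE: "topspace (subtopology ?E (?c ` (U \<times> V))) = ?c ` (U \<times> V)"
    using openin_subset[OF op] by auto
  have gc: "g (?c (p, q)) = (p, q)" if "p \<in> U" "q \<in> V" for p q
    using that inj fst_prod_coords[OF sub] snd_prod_coords[OF sub] by (simp add: g_def)
  have c_cont: "continuous_map ?T ?E ?c"
  proof -
    have "continuous_map ?T euclideanreal (\<lambda>z. if i < m then \<phi> (fst z) i else \<psi> (snd z) (i - m))" for i
      using continuous_map_compose[OF continuous_map_fst is_chart_coordinate_continuous[OF c]]
        continuous_map_compose[OF continuous_map_snd is_chart_coordinate_continuous[OF d]]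
      by (cases "i < m") (simp_all add: o_def)
    then have "continuous_map ?T ?E
        (\<lambda>z i. if i < m + n then if i < m then \<phi> (fst z) i else \<psi> (snd z) (i - m) else 0)"
      by (simp add: continuous_map_componentwise_Euclidean_space)
    then show ?thesis
    proof (rule continuous_map_eq)
      fix z assume "z \<in> topspace ?T"
      then have "\<forall>i\<ge>n. \<psi> (snd z) i = 0"
        using sub(2) unfolding topT by (auto simp: topspace_Euclidean_space)
      then show "(\<lambda>i. if i < m + n then if i < m then \<phi> (fst z) i else \<psi> (snd z) (i - m) else 0) = ?c z"
        by (auto simp: prod_coords_def case_prod_beta fun_eq_iff)
    qed
  qed
  have g_cont: "continuous_map (subtopology ?E (?c ` (U \<times> V))) ?T g"
  proof -
    have "continuous_map (subtopology ?E (?c ` (U \<times> V))) (subtopology (Euclidean_space m) (\<phi> ` U)) (fst_coords m)"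
      by (intro smooth_on_imp_continuous_map[OF smooth_on_fst_coords[OF op]]) (use image in auto)
    moreover have "continuous_map (subtopology ?E (?c ` (U \<times> V))) (subtopology (Euclidean_space n) (\<psi> ` V)) (snd_coords m)"
      by (intro smooth_on_imp_continuous_map[OF smooth_on_snd_coords[OF op]]) (use image in auto)
    ultimately have "continuous_map (subtopology ?E (?c ` (U \<times> V))) (prod_topology X Y) g"
      unfolding g_def
      using continuous_map_compose[OF _ is_chart_inv_continuous[OF c]]
        continuous_map_compose[OF _ is_chart_inv_continuous[OF d]]
      by (intro continuous_map_pairedI) (simp_all add: o_def)
    then have "continuous_map (subtopology ?E (?c ` (U \<times> V))) (subtopology (prod_topology X Y) (U \<times> V)) g"
      using gc by (auto simp: continuous_map_in_subtopology topE)
    then show ?thesis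
      by (simp add: subtopology_Times)
  qed
  have "homeomorphic_maps ?T (subtopology ?E (?c ` (U \<times> V))) ?c g"
    unfolding homeomorphic_maps_def
  proof (intro conjI ballI g_cont)
    show "continuous_map ?T (subtopology ?E (?c ` (U \<times> V))) ?c"
      using c_cont topT by (auto simp: continuous_map_in_subtopology)
    show "g (?c z) = z" if "z \<in> topspace ?T" for z
      using that gc unfolding topT by auto
    show "?c (g y) = y" if "y \<in> topspace (subtopology ?E (?c ` (U \<times> V)))" for y
      using that gc unfolding topE by auto
  qed
  then have "homeomorphic_map (subtopology (prod_topology X Y) (U \<times> V)) (subtopology ?E (?c ` (U \<times> V))) ?c"
    by (auto simp: homeomorphic_map_maps subtopology_Times)
  moreover have "openin (prod_topology X Y) (U \<times> V)"
    using is_chart_openD[OF c] is_chart_openD[OF d] by (simp add: openin_prod_Times_iff)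
  ultimately show ?thesis
    using op by (simp add: is_chart.simps)
qed

lemma prod_transition_smooth:
  assumes c: "is_chart X (m, U, \<phi>)" and d: "is_chart Y (n, V, \<psi>)"
    and F: "smooth_on m (\<phi> ` (U \<inter> U')) m' (\<phi>' \<circ> inv_into U \<phi>)"
    and G: "smooth_on n (\<psi> ` (V \<inter> V')) n' (\<psi>' \<circ> inv_into V \<psi>)"
  shows "smooth_on (m + n) (prod_coords m \<phi> \<psi> ` ((U \<times> V) \<inter> (U' \<times> V'))) (m' + n')
    (prod_coords m' \<phi>' \<psi>' \<circ> inv_into (U \<times> V) (prod_coords m \<phi> \<psi>))"
proof -
  let ?S = "prod_coords m \<phi> \<psi> ` ((U \<inter> U') \<times> (V \<inter> V'))"
  note sub = is_chart_image_subset[OF c] is_chart_image_subset[OF d]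
  have sub': "\<phi> ` (U \<inter> U') \<subseteq> topspace (Euclidean_space m)" "\<psi> ` (V \<inter> V') \<subseteq> topspace (Euclidean_space n)"
    using sub by auto
  note inj = is_chart_inj_onD[OF c] is_chart_inj_onD[OF d] is_chart_inj_onD[OF is_chart_prod[OF c d]]
  note image = prod_coords_image[OF sub']
  have S: "openin (Euclidean_space (m + n)) ?S"
    unfolding image using F G by (intro open_coords_product smooth_on_openD)
  have "smooth_on (m + n) ?S m' ((\<phi>' \<circ> inv_into U \<phi>) \<circ> fst_coords m)"
    by (intro smooth_on_compose[OF smooth_on_fst_coords[OF S] F]) (use image in auto)
  moreover have "smooth_on (m + n) ?S n' ((\<psi>' \<circ> inv_into V \<psi>) \<circ> snd_coords m)"
    by (intro smooth_on_compose[OF smooth_on_snd_coords[OF S] G]) (use image in auto)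
  ultimately have "smooth_on (m + n) ?S (m' + n') (\<lambda>y i. if i < m'
      then ((\<phi>' \<circ> inv_into U \<phi>) \<circ> fst_coords m) y i else ((\<psi>' \<circ> inv_into V \<psi>) \<circ> snd_coords m) y (i - m'))"
    by (rule smooth_on_pair)
  then have "smooth_on (m + n) ?S (m' + n')
      (prod_coords m' \<phi>' \<psi>' \<circ> inv_into (U \<times> V) (prod_coords m \<phi> \<psi>))"
  proof (rule smooth_on_cong)
    fix y assume "y \<in> ?S"
    then obtain p q where pq: "p \<in> U" "q \<in> V" "y = prod_coords m \<phi> \<psi> (p, q)"
      by auto
    then have "inv_into (U \<times> V) (prod_coords m \<phi> \<psi>) y = (p, q)"
      using inj(3) by (simp add: inv_into_f_f)
    moreover have "inv_into U \<phi> (fst_coords m y) = p" "inv_into V \<psi> (snd_coords m y) = q"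
      using pq inj(1,2) by (simp_all add: fst_prod_coords[OF sub] snd_prod_coords[OF sub])
    ultimately show "(\<lambda>i. if i < m' then ((\<phi>' \<circ> inv_into U \<phi>) \<circ> fst_coords m) y i
          else ((\<psi>' \<circ> inv_into V \<psi>) \<circ> snd_coords m) y (i - m'))
        = (prod_coords m' \<phi>' \<psi>' \<circ> inv_into (U \<times> V) (prod_coords m \<phi> \<psi>)) y"
      by (simp add: prod_coords_def[of m'] cong: if_cong)
  qed
  then show ?thesis
    by (simp add: Times_Int_Times)
qed

lemma prod_atlas_eq:
  "prod_atlas M N = {(m + n, U \<times> V, prod_coords m \<phi> \<psi>) | m U \<phi> n V \<psi>. (m, U, \<phi>) \<in> M \<and> (n, V, \<psi>) \<in> N}"
  by (simp add: prod_atlas_def prod_coords_def)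

lemma prod_atlasI:
  "(m, U, \<phi>) \<in> M \<Longrightarrow> (n, V, \<psi>) \<in> N \<Longrightarrow> (m + n, U \<times> V, prod_coords m \<phi> \<psi>) \<in> prod_atlas M N"
  unfolding prod_atlas_eq by blast

lemma smooth_atlas_prod:
  assumes M: "smooth_structure X M" and N: "smooth_structure Y N"
  shows "smooth_atlas (prod_topology X Y) (prod_atlas M N)"
  unfolding smooth_atlas_def
proof (intro conjI ballI)
  show "is_chart (prod_topology X Y) c" if "c \<in> prod_atlas M N" for c
    using that structure_chart[OF M] structure_chart[OF N] by (auto simp: prod_atlas_eq is_chart_prod)
  show "(\<Union>(n, U, \<phi>)\<in>prod_atlas M N. U) = topspace (prod_topology X Y)"
  proof
    show "(\<Union>(n, U, \<phi>)\<in>prod_atlas M N. U) \<subseteq> topspace (prod_topology X Y)"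
    proof clarify
      fix p q n W \<theta> assume "(n, W, \<theta>) \<in> prod_atlas M N" "(p, q) \<in> W"
      then obtain m U \<phi> k V \<psi> where "(m, U, \<phi>) \<in> M" "(k, V, \<psi>) \<in> N" "p \<in> U" "q \<in> V"
        by (auto simp: prod_atlas_eq)
      then show "(p, q) \<in> topspace (prod_topology X Y)"
        using openin_subset[OF is_chart_openD[OF structure_chart[OF M]]]
          openin_subset[OF is_chart_openD[OF structure_chart[OF N]]] by fastforce
    qed
    show "topspace (prod_topology X Y) \<subseteq> (\<Union>(n, U, \<phi>)\<in>prod_atlas M N. U)"
    proof clarify
      fix p q assume "(p, q) \<in> topspace (prod_topology X Y)"
      then have pq: "p \<in> topspace X" "q \<in> topspace Y" by auto
      obtain m U \<phi> where "(m, U, \<phi>) \<in> M" "p \<in> U"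
        using structure_covers[OF M pq(1)] .
      moreover obtain n V \<psi> where "(n, V, \<psi>) \<in> N" "q \<in> V"
        using structure_covers[OF N pq(2)] .
      ultimately have "(m + n, U \<times> V, prod_coords m \<phi> \<psi>) \<in> prod_atlas M N" "(p, q) \<in> U \<times> V"
        by (auto intro: prod_atlasI)
      then show "(p, q) \<in> (\<Union>(n, U, \<phi>)\<in>prod_atlas M N. U)"
        by (intro UN_I) auto
    qed
  qed
  fix c d assume c: "c \<in> prod_atlas M N" and d: "d \<in> prod_atlas M N"
  obtain m U \<phi> n V \<psi> where c': "c = (m + n, U \<times> V, prod_coords m \<phi> \<psi>)" "(m, U, \<phi>) \<in> M" "(n, V, \<psi>) \<in> N"
    using c by (auto simp: prod_atlas_eq)
  obtain m' U' \<phi>' n' V' \<psi>' where d': "d = (m' + n', U' \<times> V', prod_coords m' \<phi>' \<psi>')"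
    "(m', U', \<phi>') \<in> M" "(n', V', \<psi>') \<in> N"
    using d by (auto simp: prod_atlas_eq)
  note charts = structure_chart[OF M c'(2)] structure_chart[OF N c'(3)]
    structure_chart[OF M d'(2)] structure_chart[OF N d'(3)]
  have "smoothly_compatible (m, U, \<phi>) (m', U', \<phi>')" "smoothly_compatible (n, V, \<psi>) (n', V', \<psi>')"
    using structure_compatible[OF M c'(2) d'(2)] structure_compatible[OF N c'(3) d'(3)] by auto
  then show "smoothly_compatible c d"
    using prod_transition_smooth[OF charts(1,2), of U' m' \<phi>' V' n' \<psi>']
      prod_transition_smooth[OF charts(3,4), of U m \<phi> V n \<psi>]
    by (simp add: c'(1) d'(1) Int_commute)
qed

lemma smooth_structure_prod_manifold:
  "smooth_structure X M \<Longrightarrow> smooth_structure Y N \<Longrightarrow>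
    smooth_structure (prod_topology X Y) (prod_manifold X M Y N)"
  unfolding prod_manifold_def by (intro smooth_structure_maximal_atlas smooth_atlas_prod)

lemma smooth_map_fst:
  assumes M: "smooth_structure X M" and N: "smooth_structure Y N" and S: "openin (prod_topology X Y) S"
  shows "smooth_map (prod_manifold X M Y N) M S fst"
proof (rule smooth_mapI)
  fix z assume "z \<in> S"
  then obtain p q where z: "z = (p, q)" "(p, q) \<in> S" by (cases z) auto
  obtain U V where UV: "openin X U" "openin Y V" "p \<in> U" "q \<in> V" "U \<times> V \<subseteq> S"
    using S[unfolded openin_prod_topology_alt, rule_format, OF z(2)] by auto
  have "p \<in> topspace X" "q \<in> topspace Y"
    using UV openin_subset by blast+
  then obtain m U1 \<phi> n V1 \<psi> where 1: "(m, U1, \<phi>) \<in> M" "p \<in> U1" "(n, V1, \<psi>) \<in> N" "q \<in> V1"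
    by (elim structure_covers[OF M] structure_covers[OF N])
  let ?U = "U1 \<inter> U" and ?V = "V1 \<inter> V"
  have "(m, ?U, \<phi>) \<in> M" "(n, ?V, \<psi>) \<in> N"
    using UV(1,2) is_chart_openD[OF structure_chart[OF M 1(1)]] is_chart_openD[OF structure_chart[OF N 1(3)]]
    by (auto intro!: structure_restrict[OF M 1(1)] structure_restrict[OF N 1(3)] openin_Int)
  note c = this
  note charts = structure_chart[OF M c(1)] structure_chart[OF N c(2)]
  note sub = is_chart_image_subset[OF charts(1)] is_chart_image_subset[OF charts(2)]
  have pc: "(m + n, ?U \<times> ?V, prod_coords m \<phi> \<psi>) \<in> prod_manifold X M Y N"
    unfolding prod_manifold_def using c
    by (intro subsetD[OF atlas_subset_maximal_atlas[OF smooth_atlas_prod[OF M N]]] prod_atlasI)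
  note pcc = structure_chart[OF smooth_structure_prod_manifold[OF M N] pc]
  have "openin (Euclidean_space (m + n)) (prod_coords m \<phi> \<psi> ` (?U \<times> ?V))"
    using is_chart_image_open[OF pcc is_chart_openD[OF pcc]] by simp
  from smooth_on_fst_coords[OF this]
  have "smooth_on (m + n) (prod_coords m \<phi> \<psi> ` (?U \<times> ?V)) m
      (\<phi> \<circ> fst \<circ> inv_into (?U \<times> ?V) (prod_coords m \<phi> \<psi>))"
  proof (rule smooth_on_cong)
    fix y assume "y \<in> prod_coords m \<phi> \<psi> ` (?U \<times> ?V)"
    then obtain a b where ab: "a \<in> ?U" "b \<in> ?V" "y = prod_coords m \<phi> \<psi> (a, b)"
      by blast
    then have "inv_into (?U \<times> ?V) (prod_coords m \<phi> \<psi>) y = (a, b)"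
      using is_chart_inj_onD[OF pcc] by (simp add: inv_into_f_f)
    then show "fst_coords m y = (\<phi> \<circ> fst \<circ> inv_into (?U \<times> ?V) (prod_coords m \<phi> \<psi>)) y"
      using ab(3) fst_prod_coords[OF sub ab(1)] by simp
  qed
  moreover have "?U \<times> ?V \<subseteq> S" "z \<in> ?U \<times> ?V" "fst ` (?U \<times> ?V) \<subseteq> ?U"
    using UV 1 z by auto
  ultimately show "\<exists>m U \<phi> n V \<psi>. (m, U, \<phi>) \<in> prod_manifold X M Y N \<and> (n, V, \<psi>) \<in> M \<and>
     z \<in> U \<and> U \<subseteq> S \<and> fst ` U \<subseteq> V \<and> smooth_on m (\<phi> ` U) n (\<psi> \<circ> fst \<circ> inv_into U \<phi>)"
    using pc c(1) by meson
qed


section \<open>Etale groupoids and bisections\<close>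

context
  fixes G :: "'a groupoid"
  assumes etale: "etale_groupoid G"
begin

lemma rng_in_units: "g \<in> topspace (arrows G) \<Longrightarrow> rng G g \<in> topspace (unit_space G)"
  and rng_unit: "u \<in> topspace (unit_space G) \<Longrightarrow> rng G u = u"
  and topspace_unit_space: "topspace (unit_space G) = units G"
  using etale
  by (auto simp: etale_groupoid_def topological_groupoid_def algebraic_groupoid_def unit_space_def)

lemma rng_continuous: "continuous_map (arrows G) (unit_space G) (rng G)"
  using etale by (simp add: etale_groupoid_def topological_groupoid_def)

lemma open_bisection_openD: "open_bisection G B \<Longrightarrow> openin (arrows G) B"
  and open_bisection_inj_rng: "open_bisection G B \<Longrightarrow> inj_on (rng G) B"
  and open_bisection_inj_src: "open_bisection G B \<Longrightarrow> inj_on (src G) B"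
  and open_bisection_rng_open: "open_bisection G B \<Longrightarrow> openin (unit_space G) (rng G ` B)"
  and open_bisection_src_open: "open_bisection G B \<Longrightarrow> openin (unit_space G) (src G ` B)"
  unfolding open_bisection_def
  by (blast intro: open_embedding_on_openD open_embedding_on_inj_onD open_embedding_on_image_openD)+

text \<open>Intersecting a neighbourhood on which r is an open embedding with one on which s is.\<close>

lemma open_bisection_basis:
  assumes W: "openin (arrows G) W" and g: "g \<in> W"
  obtains B where "open_bisection G B" "g \<in> B" "B \<subseteq> W"
proof -
  have "g \<in> topspace (arrows G)"
    using W g openin_subset by blast
  then obtain U V where U: "g \<in> U" "open_embedding_on (arrows G) (unit_space G) U (rng G)"
    and V: "g \<in> V" "open_embedding_on (arrows G) (unit_space G) V (src G)"
    using etale unfolding etale_groupoid_def local_homeomorphism_def by blast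
  have op: "openin (arrows G) (U \<inter> V \<inter> W)"
    using W open_embedding_on_openD[OF U(2)] open_embedding_on_openD[OF V(2)] by (intro openin_Int)
  have "open_bisection G (U \<inter> V \<inter> W)"
    unfolding open_bisection_def
    by (intro conjI open_embedding_on_subset[OF U(2) op] open_embedding_on_subset[OF V(2) op]) auto
  then show ?thesis
    using U V g by (intro that[of "U \<inter> V \<inter> W"]) auto
qed

end


section \<open>The bisection atlas\<close>

context
  fixes G :: "'a groupoid" and M0 A :: "'a chart set"
  assumes etale: "etale_groupoid G"
    and unit_atlas: "smooth_atlas (unit_space G) A"
    and M0_def: "maximal_atlas (unit_space G) A = M0"
begin

lemma unit_structure: "smooth_structure (unit_space G) M0"
  using smooth_structure_maximal_atlas[OF unit_atlas] by (simp add: M0_def)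

lemma unit_atlas_subset: "A \<subseteq> M0"
  using atlas_subset_maximal_atlas[OF unit_atlas] by (simp add: M0_def)

lemma bisection_chart_at:
  assumes "openin (arrows G) P" "g \<in> P"
  obtains n W \<psi> B where "(n, W, \<psi>) \<in> A" "open_bisection G B" "g \<in> B" "B \<subseteq> P" "rng G ` B \<subseteq> W"
proof -
  have g: "g \<in> topspace (arrows G)"
    using assms openin_subset by blast
  have "rng G g \<in> (\<Union>(n, W, \<psi>)\<in>A. W)"
    using unit_atlas rng_in_units[OF etale g] by (simp add: smooth_atlas_def)
  then obtain n W \<psi> where W: "(n, W, \<psi>) \<in> A" "rng G g \<in> W"
    by auto
  have "openin (unit_space G) W"
    using W(1) unit_atlas by (blast intro: is_chart_openD smooth_atlas_def[THEN iffD1, THEN conjunct1, rule_format])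
  then have "openin (arrows G) {x \<in> topspace (arrows G). rng G x \<in> W}"
    by (rule openin_continuous_map_preimage[OF rng_continuous[OF etale]])
  then have "openin (arrows G) (P \<inter> {x \<in> topspace (arrows G). rng G x \<in> W})"
    using assms(1) by (intro openin_Int)
  moreover have "g \<in> P \<inter> {x \<in> topspace (arrows G). rng G x \<in> W}"
    using W(2) g assms(2) by simp
  ultimately obtain B where "open_bisection G B" "g \<in> B" "B \<subseteq> P \<inter> {x \<in> topspace (arrows G). rng G x \<in> W}"
    by (rule open_bisection_basis[OF etale])
  then show ?thesis
    using W(1) by (intro that[of n W \<psi> B]) auto
qed

lemma bisection_chart:
  assumes "(n, W, \<psi>) \<in> A" "open_bisection G B" "rng G ` B \<subseteq> W"
  shows "is_chart (arrows G) (n, B, \<psi> \<circ> rng G)"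
  using assms unit_atlas open_embedding_on_compose[of "arrows G" "unit_space G" B "rng G" "Euclidean_space n" W \<psi>]
  by (auto simp: smooth_atlas_def is_chart_iff_open_embedding open_bisection_def)

text \<open>The range map cancels from transition maps between charts of the bisection atlas, so these are
  restrictions of transition maps of the unit space.\<close>

lemma bisection_transition_smooth:
  assumes c: "(n, W, \<psi>) \<in> A" "open_bisection G B" "rng G ` B \<subseteq> W"
    and d: "(n', W', \<psi>') \<in> A" "open_bisection G B'" "rng G ` B' \<subseteq> W'"
  shows "smooth_on n ((\<psi> \<circ> rng G) ` (B \<inter> B')) n' ((\<psi>' \<circ> rng G) \<circ> inv_into B (\<psi> \<circ> rng G))"
proof -
  note C = bisection_chart[OF c]
  have W: "is_chart (unit_space G) (n, W, \<psi>)"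
    and t: "smooth_on n (\<psi> ` (W \<inter> W')) n' (\<psi>' \<circ> inv_into W \<psi>)"
    using unit_atlas c(1) d(1) by (fastforce simp: smooth_atlas_def)+
  have "openin (Euclidean_space n) ((\<psi> \<circ> rng G) ` (B \<inter> B'))"
    using open_bisection_openD[OF etale] c(2) d(2) by (intro is_chart_image_open[OF C] openin_Int) auto
  moreover have "(\<psi> \<circ> rng G) ` (B \<inter> B') \<subseteq> \<psi> ` (W \<inter> W')"
    using c(3) d(3) by auto
  ultimately have "smooth_on n ((\<psi> \<circ> rng G) ` (B \<inter> B')) n' (\<psi>' \<circ> inv_into W \<psi>)"
    by (rule smooth_on_subset[OF t])
  then show ?thesis
  proof (rule smooth_on_cong)
    fix y assume "y \<in> (\<psi> \<circ> rng G) ` (B \<inter> B')"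
    then obtain b where b: "b \<in> B" "y = (\<psi> \<circ> rng G) b" by blast
    have "inv_into B (\<psi> \<circ> rng G) y = b"
      unfolding b(2) using is_chart_inj_onD[OF C] b(1) by (rule inv_into_f_f)
    moreover have "inv_into W \<psi> y = rng G b"
      using is_chart_inj_onD[OF W] b c(3) by (auto simp: inv_into_f_f)
    ultimately show "(\<psi>' \<circ> inv_into W \<psi>) y = ((\<psi>' \<circ> rng G) \<circ> inv_into B (\<psi> \<circ> rng G)) y"
      by simp
  qed
qed

lemma smooth_atlas_bisection: "smooth_atlas (arrows G) (bisection_atlas G A)"
  unfolding smooth_atlas_def
proof (intro conjI ballI)
  show "is_chart (arrows G) c" if "c \<in> bisection_atlas G A" for c
    using that bisection_chart by (auto simp: bisection_atlas_def)
  show "(\<Union>(n, U, \<phi>)\<in>bisection_atlas G A. U) = topspace (arrows G)"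
  proof
    show "(\<Union>(n, U, \<phi>)\<in>bisection_atlas G A. U) \<subseteq> topspace (arrows G)"
      using openin_subset[OF open_bisection_openD[OF etale]] by (auto simp: bisection_atlas_def)
    show "topspace (arrows G) \<subseteq> (\<Union>(n, U, \<phi>)\<in>bisection_atlas G A. U)"
    proof
      fix g assume g: "g \<in> topspace (arrows G)"
      obtain n W \<psi> B where *: "(n, W, \<psi>) \<in> A" "open_bisection G B" "g \<in> B" "B \<subseteq> topspace (arrows G)" "rng G ` B \<subseteq> W"
        by (rule bisection_chart_at[OF openin_topspace g])
      then have "(n, B, \<psi> \<circ> rng G) \<in> bisection_atlas G A"
        by (auto simp: bisection_atlas_def)
      then show "g \<in> (\<Union>(n, U, \<phi>)\<in>bisection_atlas G A. U)"
        using *(3) by (intro UN_I) auto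
    qed
  qed
  fix c d assume cd: "c \<in> bisection_atlas G A" "d \<in> bisection_atlas G A"
  obtain n B W \<psi> where c: "c = (n, B, \<psi> \<circ> rng G)" "(n, W, \<psi>) \<in> A" "open_bisection G B" "rng G ` B \<subseteq> W"
    using cd(1) by (auto simp: bisection_atlas_def)
  obtain n' B' W' \<psi>' where d: "d = (n', B', \<psi>' \<circ> rng G)" "(n', W', \<psi>') \<in> A" "open_bisection G B'" "rng G ` B' \<subseteq> W'"
    using cd(2) by (auto simp: bisection_atlas_def)
  show "smoothly_compatible c d"
    using bisection_transition_smooth[OF c(2-4) d(2-4)] bisection_transition_smooth[OF d(2-4) c(2-4)]
    by (simp add: c(1) d(1) Int_commute)
qed

abbreviation bisection_structure :: "'a chart set" where
  "bisection_structure \<equiv> maximal_atlas (arrows G) (bisection_atlas G A)"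

lemma bisection_structure: "smooth_structure (arrows G) bisection_structure"
  by (rule smooth_structure_maximal_atlas[OF smooth_atlas_bisection])

lemma bisection_chart_in_structure:
  assumes "(n, W, \<psi>) \<in> A" "open_bisection G B" "rng G ` B \<subseteq> W"
  shows "(n, B, \<psi> \<circ> rng G) \<in> bisection_structure"
  using assms by (intro subsetD[OF atlas_subset_maximal_atlas[OF smooth_atlas_bisection]])
    (auto simp: bisection_atlas_def)

text \<open>Read in a chart \<open>(B, \<psi> \<circ> r)\<close> and the chart \<open>\<psi>\<close> of the unit space, the range map and its local
  inverses are the identity of a Cartesian space.\<close>

lemma rng_smooth: "smooth_map bisection_structure M0 (topspace (arrows G)) (rng G)"
proof (rule smooth_mapI)
  fix g assume g: "g \<in> topspace (arrows G)"
  obtain n W \<psi> B where *: "(n, W, \<psi>) \<in> A" "open_bisection G B" "g \<in> B" "B \<subseteq> topspace (arrows G)" "rng G ` B \<subseteq> W"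
    by (rule bisection_chart_at[OF openin_topspace g])
  note C = bisection_chart[OF *(1,2,5)]
  have "openin (Euclidean_space n) ((\<psi> \<circ> rng G) ` B)"
    using is_chart_image_open[OF C is_chart_openD[OF C]] by simp
  from smooth_on_id[OF this]
  have "smooth_on n ((\<psi> \<circ> rng G) ` B) n (\<psi> \<circ> rng G \<circ> inv_into B (\<psi> \<circ> rng G))"
    by (rule smooth_on_cong) (metis comp_apply f_inv_into_f)
  then show "\<exists>m U \<phi> n V \<psi>. (m, U, \<phi>) \<in> bisection_structure \<and> (n, V, \<psi>) \<in> M0 \<and>
     g \<in> U \<and> U \<subseteq> topspace (arrows G) \<and> rng G ` U \<subseteq> V \<and>
     smooth_on m (\<phi> ` U) n (\<psi> \<circ> rng G \<circ> inv_into U \<phi>)"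
    using bisection_chart_in_structure[OF *(1,2,5)] *(1,3-5) unit_atlas_subset by blast
qed

lemma bisection_section_smooth:
  assumes B: "open_bisection G B"
  shows "smooth_map M0 bisection_structure (rng G ` B) (inv_into B (rng G))"
proof (rule smooth_mapI)
  fix u assume "u \<in> rng G ` B"
  then obtain b where b: "b \<in> B" "u = rng G b" by blast
  obtain n W \<psi> B' where *: "(n, W, \<psi>) \<in> A" "open_bisection G B'" "b \<in> B'" "B' \<subseteq> B" "rng G ` B' \<subseteq> W"
    using bisection_chart_at[OF open_bisection_openD[OF etale B] b(1)] .
  note op = open_bisection_rng_open[OF etale *(2)]
  have c: "(n, rng G ` B', \<psi>) \<in> M0"
    using structure_restrict[OF unit_structure subsetD[OF unit_atlas_subset *(1)] op *(5)] .
  note C = structure_chart[OF unit_structure c]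
  have inv: "inv_into B (rng G) (rng G x) = x" if "x \<in> B'" for x
    using that *(4) open_bisection_inj_rng[OF etale B] by (auto simp: inv_into_f_f)
  have "openin (Euclidean_space n) (\<psi> ` rng G ` B')"
    using is_chart_image_open[OF C is_chart_openD[OF C]] by simp
  from smooth_on_id[OF this]
  have "smooth_on n (\<psi> ` rng G ` B') n ((\<psi> \<circ> rng G) \<circ> inv_into B (rng G) \<circ> inv_into (rng G ` B') \<psi>)"
    by (rule smooth_on_cong) (use is_chart_inj_onD[OF C] inv in \<open>auto simp: inv_into_f_f\<close>)
  moreover have "inv_into B (rng G) ` rng G ` B' \<subseteq> B'"
    using inv by auto
  moreover have "u \<in> rng G ` B'" "rng G ` B' \<subseteq> rng G ` B"
    using *(3,4) b by auto
  ultimately show "\<exists>m U \<phi> n V \<psi>'. (m, U, \<phi>) \<in> M0 \<and> (n, V, \<psi>') \<in> bisection_structure \<and>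
     u \<in> U \<and> U \<subseteq> rng G ` B \<and> inv_into B (rng G) ` U \<subseteq> V \<and>
     smooth_on m (\<phi> ` U) n (\<psi>' \<circ> inv_into B (rng G) \<circ> inv_into U \<phi>)"
    using c bisection_chart_in_structure[OF *(1,2,5)] by blast
qed

text \<open>By continuity f stays locally in one bisection, where a smooth inverse of r recovers it from its
  composition with r.  This reduces the smoothness of the inclusion of units and of inversion, and half of the
  uniqueness of the structure, to maps into the unit space.\<close>

lemma smooth_map_via_rng:
  assumes P: "smooth_structure Z P" and "f ` S \<subseteq> topspace (arrows G)"
    and cont: "\<And>W. openin (arrows G) W \<Longrightarrow> openin Z {x \<in> S. f x \<in> W}"
    and rf: "smooth_map P M0 S (rng G \<circ> f)"
  shows "smooth_map P bisection_structure S f"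
proof (rule smooth_map_locally)
  fix x assume x: "x \<in> S"
  then have "f x \<in> topspace (arrows G)"
    using assms(2) by blast
  then obtain B where B: "open_bisection G B" "f x \<in> B"
    using open_bisection_basis[OF etale openin_topspace] by metis
  let ?S = "{x \<in> S. f x \<in> B}"
  have "smooth_map P M0 ?S (rng G \<circ> f)"
    using cont[OF open_bisection_openD[OF etale B(1)]] by (intro smooth_map_subset[OF P rf]) auto
  then have "smooth_map P bisection_structure ?S (inv_into B (rng G) \<circ> (rng G \<circ> f))"
    using bisection_section_smooth[OF B(1)] by (rule smooth_map_compose[OF P unit_structure]) auto
  then have "smooth_map P bisection_structure ?S f"
    by (rule smooth_map_cong) (use open_bisection_inj_rng[OF etale B(1)] in \<open>auto simp: inv_into_f_f\<close>)
  then show "\<exists>S'. x \<in> S' \<and> S' \<subseteq> S \<and> smooth_map P bisection_structure S' f"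
    using x B(2) by (intro exI[of _ ?S]) auto
qed

lemma rng_diffeomorphism_on_bisection:
  assumes B: "open_bisection G B"
  shows "diffeomorphism bisection_structure M0 B (rng G ` B) (rng G)"
proof (rule diffeomorphismI)
  have op: "openin (arrows G) B"
    using open_bisection_openD[OF etale B] .
  show "smooth_map bisection_structure M0 B (rng G)"
    using smooth_map_subset[OF bisection_structure rng_smooth op openin_subset[OF op]] .
  show "smooth_map M0 bisection_structure (rng G ` B) (inv_into B (rng G))"
    using bisection_section_smooth[OF B] .
qed (use open_bisection_inj_rng[OF etale B] in \<open>auto simp: inv_into_f_f\<close>)

lemma rng_local_diffeomorphism:
  "local_diffeomorphism (arrows G) bisection_structure (unit_space G) M0 (rng G)"
  unfolding local_diffeomorphism_def
proof
  fix g assume "g \<in> topspace (arrows G)"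
  then obtain B where B: "open_bisection G B" "g \<in> B"
    using open_bisection_basis[OF etale openin_topspace] by metis
  then show "\<exists>U. g \<in> U \<and> openin (arrows G) U \<and> openin (unit_space G) (rng G ` U) \<and>
      diffeomorphism bisection_structure M0 U (rng G ` U) (rng G)"
    using rng_diffeomorphism_on_bisection open_bisection_openD[OF etale] open_bisection_rng_open[OF etale]
    by blast
qed

text \<open>On a bisection that acts smoothly, the source map is the range map followed by the action.\<close>

lemma src_local_diffeomorphism:
  assumes "acts_smoothly G M0"
  shows "local_diffeomorphism (arrows G) bisection_structure (unit_space G) M0 (src G)"
  unfolding local_diffeomorphism_def
proof
  fix g assume "g \<in> topspace (arrows G)"
  then obtain B where B: "open_bisection G B" "bisection_acts_smoothly G M0 B" "g \<in> B"
    using assms unfolding acts_smoothly_def by blast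
  define \<theta> where "\<theta> = src G \<circ> inv_into B (rng G)"
  have \<theta>: "smooth_map M0 M0 (rng G ` B) \<theta>" "smooth_map M0 M0 (src G ` B) (inv_into (rng G ` B) \<theta>)"
    "inj_on \<theta> (rng G ` B)"
    using B(2) by (auto simp: bisection_acts_smoothly_def diffeomorphism_def \<theta>_def bij_betw_def)
  have \<theta>r: "\<theta> (rng G b) = src G b" if "b \<in> B" for b
    using that open_bisection_inj_rng[OF etale B(1)] by (simp add: \<theta>_def inv_into_f_f)
  have \<theta>s: "inv_into (rng G ` B) \<theta> (src G b) = rng G b" if "b \<in> B" for b
    using inv_into_f_f[OF \<theta>(3), of "rng G b"] that by (simp add: \<theta>r)
  have op: "openin (arrows G) B"
    using open_bisection_openD[OF etale B(1)] .
  have "smooth_map bisection_structure M0 B (rng G)"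
    using smooth_map_subset[OF bisection_structure rng_smooth op openin_subset[OF op]] .
  then have "smooth_map bisection_structure M0 B (\<theta> \<circ> rng G)"
    using \<theta>(1) by (rule smooth_map_compose[OF bisection_structure unit_structure]) auto
  then have 1: "smooth_map bisection_structure M0 B (src G)"
    by (rule smooth_map_cong) (simp add: \<theta>r)
  have 2: "smooth_map M0 bisection_structure (src G ` B) (inv_into B (rng G) \<circ> inv_into (rng G ` B) \<theta>)"
    using \<theta>(2) bisection_section_smooth[OF B(1)]
    by (rule smooth_map_compose[OF unit_structure unit_structure]) (auto simp: \<theta>s)
  have "diffeomorphism bisection_structure M0 B (src G ` B) (src G)"
    using 1 2 by (rule diffeomorphismI)
      (use open_bisection_inj_rng[OF etale B(1)] in \<open>auto simp: \<theta>s inv_into_f_f\<close>)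
  then show "\<exists>U. g \<in> U \<and> openin (arrows G) U \<and> openin (unit_space G) (src G ` U) \<and>
      diffeomorphism bisection_structure M0 U (src G ` U) (src G)"
    using B(3) op open_bisection_src_open[OF etale B(1)] by blast
qed

section \<open>The structure maps\<close>

text \<open>The inclusion of units has r as a left inverse, so its differentials are injective; its composition
  with r is the identity, so it is smooth.\<close>

lemma unit_embedding:
  "smooth_embedding (unit_space G) M0 (arrows G) bisection_structure (\<lambda>u. u)"
proof -
  have emb: "embedding_map (unit_space G) (arrows G) (\<lambda>u. u)"
    using topspace_unit_space[OF etale]
    by (simp add: embedding_map_def unit_space_def homeomorphic_map_id[unfolded id_def])
  have units: "topspace (unit_space G) \<subseteq> topspace (arrows G)"
    by (simp add: unit_space_def)
  have smooth: "smooth_map M0 bisection_structure (topspace (unit_space G)) (\<lambda>u. u)"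
  proof (rule smooth_map_via_rng[OF unit_structure])
    show "(\<lambda>u. u) ` topspace (unit_space G) \<subseteq> topspace (arrows G)"
      using units by simp
    show "openin (unit_space G) {u \<in> topspace (unit_space G). u \<in> W}" if "openin (arrows G) W" for W
      using that by (auto simp: unit_space_def openin_subtopology)
    have "smooth_map M0 M0 (topspace (unit_space G)) (\<lambda>u. u)"
    proof (rule smooth_mapI)
      fix u assume "u \<in> topspace (unit_space G)"
      then obtain n U \<phi> where c: "(n, U, \<phi>) \<in> M0" "u \<in> U"
        using structure_covers[OF unit_structure] by metis
      note C = structure_chart[OF unit_structure c(1)]
      have "openin (Euclidean_space n) (\<phi> ` U)"
        using is_chart_image_open[OF C is_chart_openD[OF C]] by simp
      from smooth_on_id[OF this]
      have "smooth_on n (\<phi> ` U) n (\<phi> \<circ> (\<lambda>u. u) \<circ> inv_into U \<phi>)"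
        by (rule smooth_on_cong) (simp add: f_inv_into_f)
      then show "\<exists>m U \<phi> n V \<psi>. (m, U, \<phi>) \<in> M0 \<and> (n, V, \<psi>) \<in> M0 \<and> u \<in> U \<and>
          U \<subseteq> topspace (unit_space G) \<and> (\<lambda>u. u) ` U \<subseteq> V \<and>
          smooth_on m (\<phi> ` U) n (\<psi> \<circ> (\<lambda>u. u) \<circ> inv_into U \<phi>)"
        using c openin_subset[OF is_chart_openD[OF C]] by blast
    qed
    then show "smooth_map M0 M0 (topspace (unit_space G)) (rng G \<circ> (\<lambda>u. u))"
      by (rule smooth_map_cong) (simp add: rng_unit[OF etale])
  qed
  have "inj_on (differential m n (\<psi> \<circ> (\<lambda>u. u) \<circ> inv_into U \<phi>) (\<phi> u)) (topspace (Euclidean_space m))"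
    if c: "(m, U, \<phi>) \<in> M0" "(n, V, \<psi>) \<in> bisection_structure" and u: "u \<in> U" "u \<in> V" for m U \<phi> n V \<psi> u
  proof (rule inj_on_inverseI)
    fix v assume v: "v \<in> topspace (Euclidean_space m)"
    have "u \<in> topspace (unit_space G)"
      using u(1) openin_subset[OF is_chart_openD[OF structure_chart[OF unit_structure c(1)]]] by blast
    then show "differential n m (\<phi> \<circ> rng G \<circ> inv_into V \<psi>) (\<psi> u)
        (differential m n (\<psi> \<circ> (\<lambda>u. u) \<circ> inv_into U \<phi>) (\<phi> u) v) = v"
      using units
      by (intro differential_left_inverse[OF unit_structure bisection_structure smooth rng_smooth
            rng_unit[OF etale] c _ u(1) _ u(2) v]) auto
  qed
  then show ?thesis
    unfolding smooth_embedding_def immersion_def using smooth emb by blast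
qed

text \<open>The range of the inverse of an arrow is the source of the arrow.\<close>

lemma invert_smooth:
  assumes src: "smooth_map bisection_structure M0 (topspace (arrows G)) (src G)"
  shows "smooth_map bisection_structure bisection_structure (topspace (arrows G)) (invert G)"
proof (rule smooth_map_via_rng[OF bisection_structure])
  have alg: "invert G g \<in> topspace (arrows G)" "rng G (invert G g) = src G g"
    if "g \<in> topspace (arrows G)" for g
    using etale that by (auto simp: etale_groupoid_def topological_groupoid_def algebraic_groupoid_def)
  show "invert G ` topspace (arrows G) \<subseteq> topspace (arrows G)"
    using alg(1) by blast
  have "continuous_map (arrows G) (arrows G) (invert G)"
    using etale by (simp add: etale_groupoid_def topological_groupoid_def)
  then show "openin (arrows G) {x \<in> topspace (arrows G). invert G x \<in> W}" if "openin (arrows G) W" for W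
    using that by (rule openin_continuous_map_preimage)
  show "smooth_map bisection_structure M0 (topspace (arrows G)) (rng G \<circ> invert G)"
    using src by (rule smooth_map_cong) (simp add: alg(2))
qed

text \<open>Since \<open>r (g h) = r g\<close>, near a composable pair the product is given by the range of the first
  factor alone, through the local inverse of the range map at the product.  This formula makes sense also
  for pairs that are not composable and thus extends multiplication to an open set.\<close>

lemma mult_smooth:
  "smooth_map_on_subset (prod_manifold (arrows G) bisection_structure (arrows G) bisection_structure)
    bisection_structure (composable G) (\<lambda>(g, h). mult G g h)"
  unfolding smooth_map_on_subset_def
proof
  let ?P = "prod_topology (arrows G) (arrows G)"
  let ?MP = "prod_manifold (arrows G) bisection_structure (arrows G) bisection_structure"
  let ?mult = "\<lambda>(g, h). mult G g h"
  note MP = smooth_structure_prod_manifold[OF bisection_structure bisection_structure]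
  have alg: "?mult z \<in> topspace (arrows G)" "rng G (?mult z) = rng G (fst z)" if "z \<in> composable G" for z
    using etale that
    by (auto simp: etale_groupoid_def topological_groupoid_def algebraic_groupoid_def case_prod_beta)
  have comp: "composable G \<subseteq> topspace ?P"
    by (auto simp: composable_def)
  fix z0 assume z0: "z0 \<in> composable G"
  obtain B where B: "open_bisection G B" "?mult z0 \<in> B"
    using open_bisection_basis[OF etale openin_topspace alg(1)[OF z0]] by metis
  have "continuous_map (subtopology ?P (composable G)) (arrows G) ?mult"
    using etale by (simp add: etale_groupoid_def topological_groupoid_def)
  from openin_continuous_map_preimage[OF this open_bisection_openD[OF etale B(1)]]
  obtain W0 where W0: "openin ?P W0"
    "{z \<in> topspace (subtopology ?P (composable G)). ?mult z \<in> B} = W0 \<inter> composable G"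
    by (auto simp: openin_subtopology)
  have mB: "?mult z \<in> B \<longleftrightarrow> z \<in> W0" if "z \<in> composable G" for z
    using W0(2) that comp by auto
  have rf: "smooth_map ?MP M0 W0 (rng G \<circ> fst)"
    using smooth_map_fst[OF bisection_structure bisection_structure W0(1)] rng_smooth
    by (rule smooth_map_compose[OF MP bisection_structure]) (use openin_subset[OF W0(1)] in auto)
  (* On W0, composable pairs have their product in B; the ranges are restricted further so that the
     local inverse of r on B applies also to pairs that are not composable. *)
  define W where "W = {z \<in> W0. (rng G \<circ> fst) z \<in> rng G ` B}"
  have W: "openin ?P W" "W \<subseteq> W0"
    using smooth_map_preimage_open[OF MP unit_structure rf open_bisection_rng_open[OF etale B(1)]]
    by (auto simp: W_def)
  have "smooth_map ?MP bisection_structure W (inv_into B (rng G) \<circ> (rng G \<circ> fst))"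
    using smooth_map_subset[OF MP rf W] bisection_section_smooth[OF B(1)]
    by (rule smooth_map_compose[OF MP unit_structure]) (auto simp: W_def)
  moreover have "(inv_into B (rng G) \<circ> (rng G \<circ> fst)) z = ?mult z" if "z \<in> composable G \<inter> W" for z
  proof -
    have "?mult z \<in> B" "rng G (fst z) = rng G (?mult z)"
      using that mB W(2) alg(2) by auto
    then show ?thesis
      using open_bisection_inj_rng[OF etale B(1)] by (simp add: inv_into_f_f)
  qed
  moreover have "z0 \<in> W"
    using mB[OF z0] B(2) alg(2)[OF z0] by (auto simp: W_def intro!: image_eqI[of _ _ "?mult z0"])
  ultimately show "\<exists>W F. z0 \<in> W \<and> smooth_map ?MP bisection_structure W F \<and>
      (\<forall>q\<in>composable G \<inter> W. F q = ?mult q)"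
    by blast
qed

lemma acts_smoothly_imp_etale_lie_groupoid:
  assumes acts: "acts_smoothly G M0" and "manifold (unit_space G) M0"
    and "second_countable (arrows G)"
  shows "etale_lie_groupoid G M0 bisection_structure"
proof -
  have top: "topological_groupoid G"
    using etale by (simp add: etale_groupoid_def)
  have "manifold (arrows G) bisection_structure"
    using bisection_structure assms(3) top
    by (simp add: manifold_def smooth_structure_def topological_groupoid_def)
  moreover note sub = local_diffeomorphism_imp_submersion[OF bisection_structure unit_structure]
  note r = rng_local_diffeomorphism and s = src_local_diffeomorphism[OF acts]
  have "smooth_map bisection_structure M0 (topspace (arrows G)) (src G)"
    using sub[OF s] by (simp add: submersion_def)
  ultimately show ?thesis
    using top assms(2) unit_embedding sub[OF r] sub[OF s] mult_smooth invert_smooth r s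
    by (simp add: etale_lie_groupoid_def lie_groupoid_def)
qed

section \<open>Etale Lie groupoid structures\<close>

lemma local_inverse_smooth_on_bisection:
  assumes M: "smooth_structure (arrows G) M"
    and f: "diffeomorphism M M0 U (f ` U) f" and B: "openin (unit_space G) (f ` B)" "B \<subseteq> U"
  shows "smooth_map M0 M (f ` B) (inv_into B f)"
proof -
  have inj: "inj_on f U" and inv: "smooth_map M0 M (f ` U) (inv_into U f)"
    using f by (auto simp: diffeomorphism_def bij_betw_def)
  have "smooth_map M0 M (f ` B) (inv_into U f)"
    using smooth_map_subset[OF unit_structure inv B(1) image_mono[OF B(2)]] .
  then show ?thesis
    by (rule smooth_map_cong) (simp add: inv_into_subset_eq[OF inj B(2)])
qed

lemma etale_lie_groupoid_structure:
  "etale_lie_groupoid G M0 M \<Longrightarrow> smooth_structure (arrows G) M"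
  by (simp add: etale_lie_groupoid_def lie_groupoid_def manifold_def smooth_structure_def)

text \<open>The bisections on which both r and s are diffeomorphisms cover G.  On such a bisection the action is
  the composition of s with a smooth inverse of r, and exchanging r and s gives its smooth inverse.\<close>

lemma etale_lie_groupoid_imp_acts_smoothly:
  assumes L: "etale_lie_groupoid G M0 M"
  shows "acts_smoothly G M0"
proof -
  note M = etale_lie_groupoid_structure[OF L]
  have smooth: "smooth_map M M0 (topspace (arrows G)) (rng G)" "smooth_map M M0 (topspace (arrows G)) (src G)"
    using L by (simp_all add: etale_lie_groupoid_def lie_groupoid_def submersion_def)
  have "\<exists>B. open_bisection G B \<and> bisection_acts_smoothly G M0 B \<and> g \<in> B"
    if g: "g \<in> topspace (arrows G)" for g
  proof -
    obtain U V where U: "g \<in> U" "openin (arrows G) U" "diffeomorphism M M0 U (rng G ` U) (rng G)"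
      and V: "g \<in> V" "openin (arrows G) V" "diffeomorphism M M0 V (src G ` V) (src G)"
      using L[unfolded etale_lie_groupoid_def local_diffeomorphism_def] g by metis
    have "openin (arrows G) (U \<inter> V)" "g \<in> U \<inter> V"
      using U V by (auto intro: openin_Int)
    then obtain B where B: "open_bisection G B" "g \<in> B" "B \<subseteq> U \<inter> V"
      using open_bisection_basis[OF etale] by metis
    have BX: "B \<subseteq> topspace (arrows G)"
      using openin_subset[OF open_bisection_openD[OF etale B(1)]] .
    have inv: "inv_into B (rng G) (rng G b) = b" "inv_into B (src G) (src G b) = b" if "b \<in> B" for b
      using that open_bisection_inj_rng[OF etale B(1)] open_bisection_inj_src[OF etale B(1)]
      by (simp_all add: inv_into_f_f)
    have "smooth_map M0 M (rng G ` B) (inv_into B (rng G))"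
      using B(3) by (intro local_inverse_smooth_on_bisection[OF M U(3) open_bisection_rng_open[OF etale B(1)]]) auto
    then have "smooth_map M0 M0 (rng G ` B) (src G \<circ> inv_into B (rng G))"
      using smooth(2) by (rule smooth_map_compose[OF unit_structure M]) (use BX inv in auto)
    moreover have "smooth_map M0 M (src G ` B) (inv_into B (src G))"
      using B(3) by (intro local_inverse_smooth_on_bisection[OF M V(3) open_bisection_src_open[OF etale B(1)]]) auto
    then have "smooth_map M0 M0 (src G ` B) (rng G \<circ> inv_into B (src G))"
      using smooth(1) by (rule smooth_map_compose[OF unit_structure M]) (use BX inv in auto)
    ultimately have "bisection_acts_smoothly G M0 B"
      unfolding bisection_acts_smoothly_def by (rule diffeomorphismI) (use inv in auto)
    then show ?thesis
      using B by blast
  qed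
  then have "\<Union>{B. open_bisection G B \<and> bisection_acts_smoothly G M0 B} = topspace (arrows G)"
    using openin_subset[OF open_bisection_openD[OF etale]] by blast
  then show ?thesis
    unfolding acts_smoothly_def
    by (intro exI[of _ "{B. open_bisection G B \<and> bisection_acts_smoothly G M0 B}"]) simp
qed

text \<open>Both structures make r a local diffeomorphism, so the identity, being locally a local inverse of r
  after r, is smooth in both directions.\<close>

lemma etale_lie_groupoid_unique:
  assumes L: "etale_lie_groupoid G M0 M"
  shows "M = bisection_structure"
proof -
  note M = etale_lie_groupoid_structure[OF L]
  have r: "smooth_map M M0 (topspace (arrows G)) (rng G)"
    using L by (simp add: etale_lie_groupoid_def lie_groupoid_def submersion_def)
  have 1: "smooth_map M bisection_structure (topspace (arrows G)) (\<lambda>x. x)"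
  proof (rule smooth_map_via_rng[OF M])
    show "openin (arrows G) {x \<in> topspace (arrows G). x \<in> W}" if "openin (arrows G) W" for W
      using openin_Int[OF openin_topspace that] by (simp add: Int_def)
    show "smooth_map M M0 (topspace (arrows G)) (rng G \<circ> (\<lambda>x. x))"
      using r by (simp add: o_def)
  qed simp
  have 2: "smooth_map bisection_structure M (topspace (arrows G)) (\<lambda>x. x)"
  proof (rule smooth_map_locally)
    fix g assume "g \<in> topspace (arrows G)"
    then obtain U where U: "g \<in> U" "openin (arrows G) U" "diffeomorphism M M0 U (rng G ` U) (rng G)"
      using L[unfolded etale_lie_groupoid_def local_diffeomorphism_def] by metis
    have inv: "smooth_map M0 M (rng G ` U) (inv_into U (rng G))" "inj_on (rng G) U"
      using U(3) by (auto simp: diffeomorphism_def bij_betw_def)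
    have "smooth_map bisection_structure M0 U (rng G)"
      using smooth_map_subset[OF bisection_structure rng_smooth U(2) openin_subset[OF U(2)]] .
    then have "smooth_map bisection_structure M U (inv_into U (rng G) \<circ> rng G)"
      using inv(1) by (rule smooth_map_compose[OF bisection_structure unit_structure]) auto
    then have "smooth_map bisection_structure M U (\<lambda>x. x)"
      by (rule smooth_map_cong) (simp add: inv_into_f_f inv(2))
    then show "\<exists>S'. g \<in> S' \<and> S' \<subseteq> topspace (arrows G) \<and> smooth_map bisection_structure M S' (\<lambda>x. x)"
      using U(1) openin_subset[OF U(2)] by blast
  qed
  show ?thesis
    using smooth_structure_subset[OF M bisection_structure 1 2]
      smooth_structure_subset[OF bisection_structure M 2 1] by (rule equalityI)
qed

end

theorem proposition3p7:
  fixes G :: "'a groupoid" and M0 A :: "'a chart set"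
  assumes "etale_groupoid G"
    and "manifold (unit_space G) M0"
    and "smooth_atlas (unit_space G) A" and "maximal_atlas (unit_space G) A = M0"
  shows "(second_countable (arrows G) \<longrightarrow> (acts_smoothly G M0 \<longleftrightarrow> (\<exists>M. etale_lie_groupoid G M0 M))) \<and>
         ((\<exists>M. etale_lie_groupoid G M0 M) \<longrightarrow> acts_smoothly G M0) \<and>
         ((\<exists>M. etale_lie_groupoid G M0 M) \<longleftrightarrow>
            etale_lie_groupoid G M0 (maximal_atlas (arrows G) (bisection_atlas G A)) \<and>
            (\<forall>M. etale_lie_groupoid G M0 M \<longrightarrow>
                 M = maximal_atlas (arrows G) (bisection_atlas G A)))"
  using acts_smoothly_imp_etale_lie_groupoid[OF assms(1,3,4) _ assms(2)]
    etale_lie_groupoid_imp_acts_smoothly[OF assms(1,3,4)]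
    etale_lie_groupoid_unique[OF assms(1,3,4)]
  by metis

end
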